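(* Let $h:\mathbb R^n\to\mathbb R$ be convex and continuously differentiable with $L_h$-Lipschitz continuous gradient, and assume that $\phi_h(x):=f(x)-h(x)+\frac{\sigma}{2}\|Ax-b\|^2$ is convex on $\mathbb R^n$. Assume $Q\succ0$, $P-A^\top Q^{-1}A\succ0$, $\mu_x:=\lambda_{\min}(P-A^\top Q^{-1}A)>L_h/2$, and $\mathcal T^{-1}(0)\ne\emptyset$. Fix $\gamma\in\bigl(-1,1-\frac{L_h}{2\mu_x}\bigr)$ and $w^0\in\mathbb R^n\times\mathbb R^m$, and let, for $k\ge0$, $$\hat w^k=\widehat{\mathcal T}_{\rm lin}(w^k),\qquad \bar w^k=(1+\gamma)\hat w^k-\gamma w^k,\qquad w^{k+1}=\frac{1}{k+2}w^0+\frac{k+1}{k+2}\bar w^k,$$ with $\hat w^k=(\hat x^k,\hat y^k)$. Let $w^\ast=(x^\ast,y^\ast)$ be the common limit of $\{w^k\}$, $\{\bar w^k\}$, $\{\hat w^k\}$ (which exists under these assumptions and belongs to $\mathcal T^{-1}(0)$). Then $w^\ast\in\mathcal T^{-1}(0)=\mathcal R^{-1}(0)$ and, for every $k\ge0$, $$r_{\mathrm{KKT}}(\hat w^k)\le\frac{2\|\mathcal E_\sigma\|}{(1+\gamma)(k+1)}\left(\sqrt{\|\mathcal M\|}+\frac{L_h}{\sqrt{\mu_x}}\right)\mathrm{dist}_{\mathcal M}\bigl(w^0,\mathcal T^{-1}(0)\bigr);$$ in particular $r_{\mathrm{KKT}}(\hat w^k)=O(1/k)$. Moreover, with $C_\ast:=\sup_{k\ge0}\bigl(\|\hat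 x^k-x^\ast\|+\|\hat y^k\|\bigr)+\|y^\ast\|$, one has $C_\ast<\infty$ and $$\bigl|\Phi(\hat x^k)-\Phi(x^\ast)\bigr|\le C_\ast\,r_{\mathrm{KKT}}(\hat w^k)\qquad\text{for every }k\ge0,$$ and consequently $|\Phi(\hat x^k)-\Phi(x^\ast)|=O(1/k)$.
   Context: Setting: $A\in\mathbb R^{m\times n}$, $b\in\mathbb R^m$, $\sigma\ge0$; $f:\mathbb R^n\to\mathbb R$ is convex and continuously differentiable with Lipschitz continuous gradient; $g:\mathbb R^n\to(-\infty,+\infty]$ is proper, closed and convex; $\Phi:=f+g$. The problem $\min_x\Phi(x)$ s.t. $Ax=b$ is assumed to have a nonempty feasible set and at least one optimal solution. $P\in\mathbb R^{n\times n}$, $Q\in\mathbb R^{m\times m}$ are self-adjoint. Define the (set-valued) maps $$\mathcal M=\begin{pmatrix} P & A^\top \\ A & Q \end{pmatrix},\quad \mathcal T(x,y)=\begin{pmatrix} \partial g(x)+\nabla f(x)-A^\top y+\sigma A^\top(Ax-b) \\ Ax-b \end{pmatrix},\quad \mathcal R(x,y)=\begin{pmatrix} \nabla f(x)+\partial g(x)-A^\top y \\ Ax-b \end{pmatrix},$$ $$\mathcal B_h(x,y)=\begin{pmatrix} \nabla h(x) \\ 0 \end{pmatrix},\qquad\mathcal A_h(x,y)=\begin{pmatrix} \partial g(x)+\nabla f(x)-\nabla h(x)-A^\top y+\sigma A^\top(Ax-b) \\ Ax-b \end{pmatrix},$$ $r_{\mathrm{KKT}}(x,y)=\mathrm{dist}(0,\mathcal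 R(x,y))$, and the linear map $\mathcal E_\sigma(u,v)=(u-\sigma A^\top v,v)$. Under the assumptions of the claim $\mathcal M\succ0$ and $\widehat{\mathcal T}_{\rm lin}(w):=(\mathcal M+\mathcal A_h)^{-1}(\mathcal Mw-\mathcal B_h(w))$ is single-valued and everywhere defined. Notation: $\|w\|_{\mathcal M}=\sqrt{\langle w,\mathcal Mw\rangle}$, $\mathrm{dist}_{\mathcal M}(w,S)=\inf_{u\in S}\|w-u\|_{\mathcal M}$; other norms are Euclidean/operator norms and $\mathrm{dist}$ is Euclidean distance. *)

theory Defs
  imports "HOL-Analysis.Analysis" "HOL-Library.Landau_Symbols"
begin

definition grad :: "('a::real_inner \<Rightarrow> real) \<Rightarrow> 'a \<Rightarrow> 'a" where
  "grad f x = (THE D. GDERIV f x :> D)"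

definition cont_differentiable :: "('a::real_inner \<Rightarrow> real) \<Rightarrow> bool" where
  "cont_differentiable f \<longleftrightarrow> (\<forall>x. f differentiable (at x)) \<and> continuous_on UNIV (grad f)"

text \<open>The library constant \<^const>\<open>epigraph\<close> is for real-valued functions only.\<close>

definition ereal_epigraph :: "('a \<Rightarrow> ereal) \<Rightarrow> ('a \<times> real) set" where
  "ereal_epigraph g = {(x, t). g x \<le> ereal t}"

definition proper_closed_convex :: "('a::real_normed_vector \<Rightarrow> ereal) \<Rightarrow> bool" where
  "proper_closed_convex g \<longleftrightarrow>
     (\<forall>x. g x \<noteq> -\<infinity>) \<and> (\<exists>x. g x \<noteq> \<infinity>) \<and>
     closed (ereal_epigraph g) \<and> convex (ereal_epigraph g)"

text \<open>For proper \<open>g\<close> this is empty at every \<open>x\<close> with \<open>g x = \<infinity>\<close>.\<close>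

definition subdifferential :: "('a::real_inner \<Rightarrow> ereal) \<Rightarrow> 'a \<Rightarrow> 'a set" where
  "subdifferential g x = {v. \<forall>z. g x + ereal (v \<bullet> (z - x)) \<le> g z}"

definition pos_def :: "real^'n^'n \<Rightarrow> bool" where
  "pos_def S \<longleftrightarrow> transpose S = S \<and> (\<forall>v. v \<noteq> 0 \<longrightarrow> 0 < v \<bullet> (S *v v))"

text \<open>Only used for symmetric \<open>S\<close>, whose set of real eigenvalues is finite and nonempty.\<close>

definition lambda_min :: "real^'n^'n \<Rightarrow> real" where
  "lambda_min S = Min {l. \<exists>v. v \<noteq> 0 \<and> S *v v = l *\<^sub>R v}"

definition Phi :: "('a \<Rightarrow> real) \<Rightarrow> ('a \<Rightarrow> ereal) \<Rightarrow> 'a \<Rightarrow> ereal" where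
  "Phi f g x = ereal (f x) + g x"

definition set_inverse :: "('a \<Rightarrow> 'b set) \<Rightarrow> 'b \<Rightarrow> 'a set" where
  "set_inverse F u = {w. u \<in> F w}"

definition M_map :: "real^'n^'n \<Rightarrow> real^'m^'m \<Rightarrow> real^'n^'m \<Rightarrow>
    (real^'n) \<times> (real^'m) \<Rightarrow> (real^'n) \<times> (real^'m)" where
  "M_map P Q A = (\<lambda>(x, y). (P *v x + transpose A *v y, A *v x + Q *v y))"

definition T_map :: "real^'n^'m \<Rightarrow> real^'m \<Rightarrow> real \<Rightarrow> (real^'n \<Rightarrow> real) \<Rightarrow> (real^'n \<Rightarrow> ereal) \<Rightarrow>
    (real^'n) \<times> (real^'m) \<Rightarrow> ((real^'n) \<times> (real^'m)) set" where
  "T_map A b \<sigma> f g = (\<lambda>(x, y).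
     {(s + grad f x - transpose A *v y + \<sigma> *\<^sub>R (transpose A *v (A *v x - b)), A *v x - b) | s.
        s \<in> subdifferential g x})"

definition R_map :: "real^'n^'m \<Rightarrow> real^'m \<Rightarrow> (real^'n \<Rightarrow> real) \<Rightarrow> (real^'n \<Rightarrow> ereal) \<Rightarrow>
    (real^'n) \<times> (real^'m) \<Rightarrow> ((real^'n) \<times> (real^'m)) set" where
  "R_map A b f g = (\<lambda>(x, y).
     {(grad f x + s - transpose A *v y, A *v x - b) | s. s \<in> subdifferential g x})"

definition B_map :: "(real^'n \<Rightarrow> real) \<Rightarrow>
    (real^'n) \<times> (real^'m) \<Rightarrow> (real^'n) \<times> (real^'m)" where
  "B_map h = (\<lambda>(x, y). (grad h x, 0))"

definition A_map :: "real^'n^'m \<Rightarrow> real^'m \<Rightarrow> real \<Rightarrow> (real^'n \<Rightarrow> real) \<Rightarrow> (real^'n \<Rightarrow> ereal) \<Rightarrow>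
    (real^'n \<Rightarrow> real) \<Rightarrow> (real^'n) \<times> (real^'m) \<Rightarrow> ((real^'n) \<times> (real^'m)) set" where
  "A_map A b \<sigma> f g h = (\<lambda>(x, y).
     {(s + grad f x - grad h x - transpose A *v y + \<sigma> *\<^sub>R (transpose A *v (A *v x - b)),
       A *v x - b) | s. s \<in> subdifferential g x})"

text \<open>\<open>(M + A\<^sub>h)\<^sup>-\<^sup>1 (M w - B\<^sub>h w)\<close> as a set, so that existence and uniqueness of its value
  are not built into the definition.\<close>

definition T_lin :: "real^'n^'n \<Rightarrow> real^'m^'m \<Rightarrow> real^'n^'m \<Rightarrow> real^'m \<Rightarrow> real \<Rightarrow>
    (real^'n \<Rightarrow> real) \<Rightarrow> (real^'n \<Rightarrow> ereal) \<Rightarrow> (real^'n \<Rightarrow> real) \<Rightarrow>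
    (real^'n) \<times> (real^'m) \<Rightarrow> ((real^'n) \<times> (real^'m)) set" where
  "T_lin P Q A b \<sigma> f g h w =
     set_inverse (\<lambda>z. (\<lambda>a. M_map P Q A z + a) ` A_map A b \<sigma> f g h z) (M_map P Q A w - B_map h w)"

text \<open>Extended-real valued, because the distance to the empty set is \<open>\<infinity>\<close> (\<^const>\<open>infdist\<close> would
  return 0).\<close>

definition r_KKT :: "real^'n^'m \<Rightarrow> real^'m \<Rightarrow> (real^'n \<Rightarrow> real) \<Rightarrow> (real^'n \<Rightarrow> ereal) \<Rightarrow>
    (real^'n) \<times> (real^'m) \<Rightarrow> ereal" where
  "r_KKT A b f g w = (INF u \<in> R_map A b f g w. ereal (dist 0 u))"

definition E_map :: "real^'n^'m \<Rightarrow> real \<Rightarrow> (real^'n) \<times> (real^'m) \<Rightarrow> (real^'n) \<times> (real^'m)" where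
  "E_map A \<sigma> = (\<lambda>(u, v). (u - \<sigma> *\<^sub>R (transpose A *v v), v))"

definition norm_wrt :: "('a::real_inner \<Rightarrow> 'a) \<Rightarrow> 'a \<Rightarrow> real" where
  "norm_wrt M w = sqrt (w \<bullet> M w)"

text \<open>Only used for nonempty \<open>S\<close>.\<close>

definition dist_wrt :: "('a::real_inner \<Rightarrow> 'a) \<Rightarrow> 'a \<Rightarrow> 'a set \<Rightarrow> real" where
  "dist_wrt M w S = (INF u \<in> S. norm_wrt M (w - u))"

end

(*
In the inner product of M, cocoercivity of grad h (Baillon-Haddad) and mu_x > L_h / 2 make the
relaxed map F = (1 + gamma) T_lin - gamma id nonexpansive, and its fixed points are the zeros of T.
The iteration is therefore the Halpern iteration of F: it converges to the M-projection of w0 onto the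
zeros (Wittmann), and its residual is at most 2 / (k + 1) times the distance of w0 to them (Lieder).
The inclusion that defines what k turns M (w k - what k) + grad h (xhat k) - grad h (x k) into an
element of T (what k), which E_sigma maps into R (what k). The objective gap follows from the
subgradient inequalities at xhat k and xstar.
*)

theory Submission
  imports Defs
begin

section \<open>Gradients of convex functions\<close>

text \<open>The range of \<open>\<gamma>\<close> is an averagedness condition. For differences
  \<open>d\<close> of inputs and \<open>r\<close> of residuals \<open>w - what\<close>, monotonicity
  and cocoercivity give \<open>(1 - L / (4 * \<mu>)) * ip r r \<le> ip d r\<close>. Relaxation turns
  \<open>d\<close> into \<open>d - (1 + \<gamma>) *\<^sub>R r\<close>, which does not lengthen
  \<open>d\<close> as long as \<open>1 + \<gamma> \<le> 2 * (1 - L / (4 * \<mu>))\<close>. Moreover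
  \<open>w - what\<close> is the residual of the relaxed map divided by \<open>1 + \<gamma>\<close>,
  the source of that factor in the rate. The iteration lives in the geometry of \<open>M\<close>,
  the KKT residual in the Euclidean one. The passage costs \<open>sqrt (onorm M)\<close> for
  \<open>M\<close> applied to the residual and \<open>L / sqrt \<mu>\<close> for the gradient
  difference, which sees only the x-block. There the form is at least \<open>\<mu>\<close> times the
  squared norm, because the Schur complement is what is left of the form after minimising over the
  y-block. \<open>T_lin\<close> is given by an inclusion, so existence and uniqueness of its value
  have to be proved: uniqueness is monotonicity, existence a minimisation in x alone.\<close>

lemma grad_eqI: 
  assumes "GDERIV f x :> D" shows "grad f x = D"
  unfolding grad_def
proof (rule the_equality)
  fix E assume "GDERIV f x :> E"
  with assms have "(\<lambda>v. v \<bullet> E) = (\<lambda>v. v \<bullet> D)"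
    unfolding gderiv_def by (rule has_derivative_unique[rotated])
  then show "E = D" by (metis vector_eq_ldot)
qed fact

lemma GDERIV_grad:
  fixes f :: "'a::euclidean_space \<Rightarrow> real"
  assumes "f differentiable (at x)"
  shows "GDERIV f x :> grad f x"
proof -
  obtain f' where f': "(f has_derivative f') (at x)"
    using assms unfolding differentiable_def by blast
  \<comment> \<open>The Riesz representative of the functional \<open>f'\<close> is its adjoint
    applied to \<open>1\<close>.\<close>
  have "f' = (\<lambda>v. v \<bullet> adjoint f' 1)"
    using adjoint_works[OF has_derivative_linear[OF f']] by fastforce
  then have "GDERIV f x :> adjoint f' 1" using f' unfolding gderiv_def by simp
  then show ?thesis using grad_eqI by metis
qed

lemma GDERIV_line:
  assumes "GDERIV f (x + t *\<^sub>R v) :> D"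
  shows "DERIV (\<lambda>t. f (x + t *\<^sub>R v)) t :> D \<bullet> v"
proof -
  have "((\<lambda>t. x + t *\<^sub>R v) has_derivative (\<lambda>s. s *\<^sub>R v)) (at t)"
    by (auto intro!: derivative_eq_intros)
  from has_derivative_compose[OF this assms[unfolded gderiv_def]]
  show ?thesis by (simp add: has_field_derivative_def inner_commute mult_commute_abs)
qed

lemma convex_on_line:
  assumes "convex_on UNIV f"
  shows "convex_on UNIV (\<lambda>t. f (x + t *\<^sub>R v) :: real)"
proof (rule convex_onI)
  fix t s u :: real assume "0 < t" "t < 1"
  then have "f ((1 - t) *\<^sub>R (x + s *\<^sub>R v) + t *\<^sub>R (x + u *\<^sub>R v))
      \<le> (1 - t) * f (x + s *\<^sub>R v) + t * f (x + u *\<^sub>R v)"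
    using assms by (intro convex_onD) auto
  then show "f (x + ((1 - t) *\<^sub>R s + t *\<^sub>R u) *\<^sub>R v)
      \<le> (1 - t) * f (x + s *\<^sub>R v) + t * f (x + u *\<^sub>R v)"
    by (simp add: algebra_simps)
qed simp

lemma convex_on_above_gradient:
  assumes "convex_on UNIV f" "GDERIV f x :> D"
  shows "f x + D \<bullet> (y - x) \<le> f y"
proof -
  have "D \<bullet> (y - x) * (1 - 0) \<le> f (x + 1 *\<^sub>R (y - x)) - f (x + 0 *\<^sub>R (y - x))"
    using convex_on_line[OF assms(1)]
    by (rule convex_on_imp_above_tangent) (auto intro!: GDERIV_line assms(2))
  then show ?thesis by simp
qed

lemma convex_on_gradient_mono:
  assumes "convex_on UNIV f" "GDERIV f x :> D" "GDERIV f y :> E"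
  shows "0 \<le> (D - E) \<bullet> (x - y)"
  using convex_on_above_gradient[OF assms(1,2), of y] convex_on_above_gradient[OF assms(1,3), of x]
  by (simp add: inner_simps)

text \<open>Along the segment the right-hand side minus the left-hand side is \<open>?\<phi>\<close>
  up to a constant, and it is nondecreasing since the gradient changes by at most
  \<open>L * t * norm (y - x)\<close>. This takes the place of integrating the gradient.\<close>

lemma descent_lemma:
  fixes h :: "'a::real_inner \<Rightarrow> real"
  assumes "L-lipschitz_on UNIV D" "\<And>x. GDERIV h x :> D x"
  shows "h y \<le> h x + D x \<bullet> (y - x) + L / 2 * (norm (y - x))\<^sup>2"
proof -
  let ?v = "y - x"
  let ?\<phi> = "\<lambda>t. L / 2 * t\<^sup>2 * (norm ?v)\<^sup>2 + t * (D x \<bullet> ?v) - h (x + t *\<^sub>R ?v)"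
  have "?\<phi> 0 \<le> ?\<phi> 1"
  proof (rule DERIV_nonneg_imp_nondecreasing[of 0 1 ?\<phi>])
    fix t :: real assume t: "0 \<le> t" "t \<le> 1"
    have "DERIV ?\<phi> t :> L * t * (norm ?v)\<^sup>2 + D x \<bullet> ?v - D (x + t *\<^sub>R ?v) \<bullet> ?v"
      by (auto intro!: derivative_eq_intros GDERIV_line assms(2))
    moreover have "(D (x + t *\<^sub>R ?v) - D x) \<bullet> ?v \<le> L * t * (norm ?v)\<^sup>2"
    proof -
      have "(D (x + t *\<^sub>R ?v) - D x) \<bullet> ?v \<le> norm (D (x + t *\<^sub>R ?v) - D x) * norm ?v"
        by (rule norm_cauchy_schwarz)
      also have "\<dots> \<le> (L * norm (t *\<^sub>R ?v)) * norm ?v"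
        using lipschitz_onD[OF assms(1), of "x + t *\<^sub>R ?v" x]
        by (intro mult_right_mono) (auto simp: dist_norm)
      finally show ?thesis using t by (simp add: power2_eq_square mult_ac)
    qed
    ultimately show "\<exists>d. DERIV ?\<phi> t :> d \<and> 0 \<le> d"
      by (intro exI conjI) (assumption, simp add: inner_diff_left)
  qed simp
  then show ?thesis by simp
qed

text \<open>The minimum of \<open>h - \<langle>D x, \<cdot>\<rangle>\<close>, attained at \<open>x\<close>, is compared with the value after a gradient step
  of length \<open>1 / L\<close> from \<open>y\<close>; the claim is the sum of this and the inequality with \<open>x\<close> and \<open>y\<close>
  exchanged.\<close>

lemma convex_lipschitz_gradient_cocoercive:
  fixes h :: "'a::real_inner \<Rightarrow> real"
  assumes L: "L-lipschitz_on UNIV D" and D: "\<And>x. GDERIV h x :> D x" and cv: "convex_on UNIV h"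
  shows "(norm (D x - D y))\<^sup>2 \<le> L * ((D x - D y) \<bullet> (x - y))"
proof (cases "L = 0")
  case True
  then have "D x = D y" using lipschitz_onD[OF L, of x y] by simp
  then show ?thesis by simp
next
  case False
  then have L0: "0 < L" using lipschitz_on_nonneg[OF L] by simp
  have step: "(norm (D y - D x))\<^sup>2 / (2 * L) \<le> h y - h x - D x \<bullet> (y - x)" for x y
  proof -
    let ?d = "D y - D x" and ?z = "y - (1 / L) *\<^sub>R (D y - D x)"
    have "h x + D x \<bullet> (?z - x) \<le> h ?z"
      by (rule convex_on_above_gradient[OF cv D])
    also have "h ?z \<le> h y + D y \<bullet> (?z - y) + L / 2 * (norm (?z - y))\<^sup>2"
      by (rule descent_lemma[OF L D])
    finally have "h x + D x \<bullet> (y - x) - D x \<bullet> ?d / L \<le> h y - D y \<bullet> ?d / L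
        + L / 2 * ((norm ?d)\<^sup>2 / L\<^sup>2)"
      by (simp add: inner_diff_right norm_minus_commute power_divide power_mult_distrib)
    moreover have "D y \<bullet> ?d / L - D x \<bullet> ?d / L = (norm ?d)\<^sup>2 / L"
      by (simp add: diff_divide_distrib[symmetric] inner_diff_left[symmetric] power2_norm_eq_inner)
    moreover have "L / 2 * ((norm ?d)\<^sup>2 / L\<^sup>2) = (norm ?d)\<^sup>2 / L - (norm ?d)\<^sup>2 / (2 * L)"
      using L0 by (simp add: field_simps power2_eq_square)
    ultimately show ?thesis by linarith
  qed
  have "(norm (D x - D y))\<^sup>2 / (2 * L) * 2 \<le> (D x - D y) \<bullet> (x - y)"
    using step[of x y] step[of y x] by (simp add: inner_simps norm_minus_commute)
  then show ?thesis using L0 by (simp add: field_simps)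
qed

section \<open>Subgradients\<close>

text \<open>If \<open>g x\<close> were \<infinity>, the subgradient inequality would force
  \<infinity> at every point, against properness. This allows subgradient inequalities to be handled
  in real arithmetic.\<close>

lemma subdifferential_finite:
  assumes "proper_closed_convex g" "s \<in> subdifferential g x"
  obtains r where "g x = ereal r"
proof -
  obtain z where "g z \<noteq> \<infinity>" using assms(1) unfolding proper_closed_convex_def by blast
  moreover have "g x + ereal (s \<bullet> (z - x)) \<le> g z"
    using assms(2) unfolding subdifferential_def by blast
  ultimately have "g x \<noteq> \<infinity>" by auto
  moreover have "g x \<noteq> -\<infinity>" using assms(1) unfolding proper_closed_convex_def by blast
  ultimately show ?thesis using that by (cases "g x") auto
qed

lemma subdifferential_mono:
  assumes g: "proper_closed_convex g" and s: "s \<in> subdifferential g x" and t: "t \<in> subdifferential g y"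
  shows "0 \<le> (s - t) \<bullet> (x - y)"
proof -
  obtain a c where "g x = ereal a" "g y = ereal c"
    using subdifferential_finite[OF g s] subdifferential_finite[OF g t] by metis
  moreover have "g x + ereal (s \<bullet> (y - x)) \<le> g y" "g y + ereal (t \<bullet> (x - y)) \<le> g x"
    using s t unfolding subdifferential_def by blast+
  ultimately show ?thesis by (simp add: inner_simps)
qed

text \<open>Minimising \<open>\<psi> z + t\<close> over the epigraph of \<open>g\<close> avoids a sum rule for subdifferentials; the
  subgradient \<open>s\<^sub>0\<close> serves as the affine minorant that makes the sublevel set bounded.\<close>

lemma exists_neg_gradient_subdifferential:
  fixes g :: "'a::euclidean_space \<Rightarrow> ereal"
  assumes g: "proper_closed_convex g" and s0: "s\<^sub>0 \<in> subdifferential g x\<^sub>0"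
    and D: "\<And>x. GDERIV \<psi> x :> D x" and c: "0 < c"
    and grow: "\<And>z. \<psi> x\<^sub>0 + D x\<^sub>0 \<bullet> (z - x\<^sub>0) + c * (norm (z - x\<^sub>0))\<^sup>2 \<le> \<psi> z"
  shows "\<exists>x. - D x \<in> subdifferential g x"
proof -
  obtain r where r: "g x\<^sub>0 = ereal r" using subdifferential_finite[OF g s0] .
  define E where "E = ereal_epigraph g"
  define S where "S = {p \<in> E. \<psi> (fst p) + snd p \<le> \<psi> x\<^sub>0 + r}"
  define \<rho> where "\<rho> = norm (D x\<^sub>0 + s\<^sub>0) / c"
  have "isCont \<psi> x" for x
    using D[of x] unfolding gderiv_def by (rule has_derivative_continuous)
  then have cont: "continuous_on UNIV (\<lambda>p. \<psi> (fst p) + snd p)"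
    by (intro continuous_intros continuous_on_compose2[of UNIV \<psi> UNIV fst])
      (auto simp: continuous_at_imp_continuous_on)
  have below: "r + s\<^sub>0 \<bullet> (z - x\<^sub>0) \<le> t" if "(z, t) \<in> E" for z t
  proof -
    have "g x\<^sub>0 + ereal (s\<^sub>0 \<bullet> (z - x\<^sub>0)) \<le> g z" using s0 unfolding subdifferential_def by blast
    also have "g z \<le> ereal t" using that unfolding E_def ereal_epigraph_def by simp
    finally show ?thesis by (simp add: r)
  qed
  have "S \<subseteq> cball x\<^sub>0 \<rho> \<times> {r - norm s\<^sub>0 * \<rho> .. r + norm (D x\<^sub>0) * \<rho>}"
  proof
    fix p assume p: "p \<in> S"
    obtain z t where pz: "p = (z, t)" by (cases p)
    have zt: "(z, t) \<in> E" and le: "\<psi> z + t \<le> \<psi> x\<^sub>0 + r" using p unfolding S_def pz by auto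
    let ?d = "z - x\<^sub>0"
    \<comment> \<open>The quadratic growth of \<open>\<psi>\<close> beats the linear terms of both
      lower bounds, which confines \<open>z\<close> to the ball of radius
      \<open>\<rho>\<close>.\<close>
    have "c * (norm ?d)\<^sup>2 \<le> - ((D x\<^sub>0 + s\<^sub>0) \<bullet> ?d)"
      using below[OF zt] grow[of z] le by (simp add: inner_add_left)
    also have "\<dots> \<le> norm (D x\<^sub>0 + s\<^sub>0) * norm ?d"
      using norm_cauchy_schwarz[of "- (D x\<^sub>0 + s\<^sub>0)" ?d] by (metis inner_minus_left norm_minus_cancel)
    finally have "c * norm ?d \<le> norm (D x\<^sub>0 + s\<^sub>0)"
      by (cases "norm ?d = 0") (auto simp: power2_eq_square)
    then have d: "norm ?d \<le> \<rho>" unfolding \<rho>_def using c by (simp add: field_simps)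
    have "norm s\<^sub>0 * norm ?d \<le> norm s\<^sub>0 * \<rho>" "norm (D x\<^sub>0) * norm ?d \<le> norm (D x\<^sub>0) * \<rho>"
      using d by (auto intro: mult_left_mono)
    moreover have "\<bar>s\<^sub>0 \<bullet> ?d\<bar> \<le> norm s\<^sub>0 * norm ?d" "\<bar>D x\<^sub>0 \<bullet> ?d\<bar> \<le> norm (D x\<^sub>0) * norm ?d"
      by (rule Cauchy_Schwarz_ineq2)+
    moreover have "0 \<le> c * (norm ?d)\<^sup>2" using c by simp
    ultimately have "r - norm s\<^sub>0 * \<rho> \<le> t" "t \<le> r + norm (D x\<^sub>0) * \<rho>"
      using below[OF zt] grow[of z] le by linarith+
    then show "p \<in> cball x\<^sub>0 \<rho> \<times> {r - norm s\<^sub>0 * \<rho> .. r + norm (D x\<^sub>0) * \<rho>}"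
      using d by (simp add: pz dist_norm norm_minus_commute)
  qed
  then have "bounded S"
    by (rule bounded_subset[rotated]) (intro bounded_Times bounded_cball bounded_closed_interval)
  moreover have "closed S"
  proof -
    have "S = E \<inter> ((\<lambda>p. \<psi> (fst p) + snd p) -` {..\<psi> x\<^sub>0 + r})" unfolding S_def by auto
    moreover have "closed E" using g unfolding proper_closed_convex_def E_def by blast
    moreover have "closed ((\<lambda>p. \<psi> (fst p) + snd p) -` {..\<psi> x\<^sub>0 + r})"
      using cont by (rule closed_vimage[OF closed_atMost])
    ultimately show ?thesis by (simp add: closed_Int)
  qed
  ultimately have "compact S" by (simp add: compact_eq_bounded_closed)
  moreover have x0S: "(x\<^sub>0, r) \<in> S" unfolding S_def E_def ereal_epigraph_def by (simp add: r)
  ultimately obtain m where m: "m \<in> S" "\<And>p. p \<in> S \<Longrightarrow> \<psi> (fst m) + snd m \<le> \<psi> (fst p) + snd p"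
    using continuous_attains_inf[of S "\<lambda>p. \<psi> (fst p) + snd p"] continuous_on_subset[OF cont]
    by blast
  obtain x t where mx: "m = (x, t)" by (cases m)
  have xt: "(x, t) \<in> E" using m(1) unfolding S_def mx by simp
  have min: "\<psi> x + t \<le> \<psi> z + u" if "(z, u) \<in> E" for z u
  proof (cases "(z, u) \<in> S")
    case True then show ?thesis using m(2) by (fastforce simp: mx)
  next
    case False
    then have "\<psi> x\<^sub>0 + r < \<psi> z + u" using that unfolding S_def by simp
    then show ?thesis using m(2)[OF x0S] by (simp add: mx)
  qed
  have "g x + ereal (- D x \<bullet> (z - x)) \<le> g z" for z
  proof (cases "g z")
    case (real u)
    \<comment> \<open>The epigraph contains the segment from the minimiser \<open>(x, t)\<close> to
      \<open>(z, u)\<close>, so the objective cannot decrease at its start. That slope condition is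
      the subgradient inequality with \<open>t\<close> in place of \<open>g x\<close>, and
      \<open>g x\<close> is at most \<open>t\<close>.\<close>
    let ?\<phi> = "\<lambda>\<tau>. \<psi> (x + \<tau> *\<^sub>R (z - x)) + \<tau> * (u - t)"
    have der: "DERIV ?\<phi> 0 :> D x \<bullet> (z - x) + (u - t)"
      using D[of x] by (auto intro!: derivative_eq_intros GDERIV_line)
    have ge: "?\<phi> 0 \<le> ?\<phi> \<tau>" if \<tau>: "0 < \<tau>" "\<tau> < 1" for \<tau>
    proof -
      have "(z, u) \<in> E" unfolding E_def ereal_epigraph_def by (simp add: real)
      moreover have "convex E" using g unfolding proper_closed_convex_def E_def by blast
      ultimately have "(1 - \<tau>) *\<^sub>R (x, t) + \<tau> *\<^sub>R (z, u) \<in> E"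
        using xt \<tau> by (intro convexD) auto
      moreover have "(1 - \<tau>) *\<^sub>R (x, t) + \<tau> *\<^sub>R (z, u) = (x + \<tau> *\<^sub>R (z - x), t + \<tau> * (u - t))"
        by (simp add: algebra_simps)
      ultimately show ?thesis using min by fastforce
    qed
    have "0 \<le> D x \<bullet> (z - x) + (u - t)"
    proof (rule ccontr)
      assume "\<not> ?thesis"
      then obtain d where d: "0 < d" "\<And>\<tau>. 0 < \<tau> \<Longrightarrow> \<tau> < d \<Longrightarrow> ?\<phi> 0 > ?\<phi> (0 + \<tau>)"
        using DERIV_neg_dec_right[OF der] by auto
      define \<tau> where "\<tau> = min (d / 2) (1 / 2)"
      have "0 < \<tau>" "\<tau> < d" "\<tau> < 1" unfolding \<tau>_def using d(1) by auto
      with d(2)[of \<tau>] ge[of \<tau>] show False by simp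
    qed
    moreover have "g x + ereal (- D x \<bullet> (z - x)) \<le> ereal t + ereal (- D x \<bullet> (z - x))"
      using xt unfolding E_def ereal_epigraph_def by (intro add_right_mono) simp
    ultimately show ?thesis by (simp add: real order_trans)
  next
    case MInf
    then show ?thesis using g unfolding proper_closed_convex_def by blast
  qed simp
  then show ?thesis unfolding subdifferential_def by blast
qed

section \<open>Positive definite forms\<close>

text \<open>The type already carries the Euclidean inner product, so the form cannot be a second
  instance of \<open>real_inner\<close>; the inner product geometry that the iteration needs is
  developed for \<open>ip\<close> directly.\<close>

locale pos_def_form =
  fixes M :: "'a::euclidean_space \<Rightarrow> 'a"
  assumes lin: "linear M"
    and self_adjoint: "M x \<bullet> y = x \<bullet> M y"
    and pos: "x \<noteq> 0 \<Longrightarrow> 0 < x \<bullet> M x"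
begin

definition ip :: "'a \<Rightarrow> 'a \<Rightarrow> real" where "ip x y = x \<bullet> M y"

lemma bounded_linear_M: "bounded_linear M"
  using lin linear_conv_bounded_linear by blast

lemma ip_commute: "ip x y = ip y x"
  unfolding ip_def by (metis inner_commute self_adjoint)

lemma ip_simps:
  "ip (x + y) z = ip x z + ip y z" "ip z (x + y) = ip z x + ip z y"
  "ip (x - y) z = ip x z - ip y z" "ip z (x - y) = ip z x - ip z y"
  "ip (c *\<^sub>R x) z = c * ip x z" "ip z (c *\<^sub>R x) = c * ip z x"
  "ip (- x) z = - ip x z" "ip z (- x) = - ip z x" "ip 0 z = 0" "ip z 0 = 0"
  unfolding ip_def
  by (simp_all add: inner_simps linear_add[OF lin] linear_diff[OF lin] linear_neg[OF lin]
      linear_0[OF lin] linear_cmul[OF lin])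

lemma ip_nonneg: "0 \<le> ip x x"
  using pos[of x] unfolding ip_def by (cases "x = 0") auto

text \<open>Stated with \<le> because the arguments that conclude equality of two points produce
  only an upper bound on \<open>ip x x\<close>.\<close>

lemma ip_eq_0: "ip x x \<le> 0 \<longleftrightarrow> x = 0"
  using pos[of x] unfolding ip_def by (cases "x = 0") auto

lemma ip_minus_commute: "ip (x - y) (x - y) = ip (y - x) (y - x)"
  by (simp add: ip_simps)

lemma ip_convex_combination:
  "ip (s *\<^sub>R x + (1 - s) *\<^sub>R y) (s *\<^sub>R x + (1 - s) *\<^sub>R y)
    = s * ip x x + (1 - s) * ip y y - s * (1 - s) * ip (x - y) (x - y)"
  by (simp add: ip_simps ip_commute algebra_simps)

lemma norm_wrt_ip: "norm_wrt M x = sqrt (ip x x)"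
  unfolding norm_wrt_def ip_def ..

lemma norm_wrt_scaleR: "norm_wrt M (c *\<^sub>R x) = \<bar>c\<bar> * norm_wrt M x"
  by (simp add: norm_wrt_ip ip_simps real_sqrt_mult flip: mult.assoc)

lemma tendsto_ip:
  assumes "(f \<longlongrightarrow> a) F" "(g \<longlongrightarrow> c) F"
  shows "((\<lambda>x. ip (f x) (g x)) \<longlongrightarrow> ip a c) F"
  unfolding ip_def using assms
  by (intro tendsto_inner bounded_linear.tendsto[OF bounded_linear_M])

lemma ip_Cauchy_Schwarz: "(ip x y)\<^sup>2 \<le> ip x x * ip y y"
proof (cases "y = 0")
  case True then show ?thesis by (simp add: ip_simps)
next
  case False
  then have y: "0 < ip y y" using pos unfolding ip_def by blast
  have "0 \<le> ip (ip y y *\<^sub>R x - ip x y *\<^sub>R y) (ip y y *\<^sub>R x - ip x y *\<^sub>R y)" by (rule ip_nonneg)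
  also have "\<dots> = ip y y * (ip x x * ip y y - (ip x y)\<^sup>2)"
    by (simp add: ip_simps ip_commute algebra_simps power2_eq_square)
  finally show ?thesis using y by (simp add: zero_le_mult_iff)
qed

text \<open>Cauchy-Schwarz for \<open>ip\<close> at \<open>x\<close> and \<open>M x\<close> avoids
  the square root of \<open>M\<close>: by self-adjointness \<open>ip x (M x)\<close> is the squared
  norm of \<open>M x\<close>, and one such factor cancels.\<close>

lemma norm_wrt_bound: "norm (M x) \<le> sqrt (onorm M) * norm_wrt M x"
proof (cases "M x = 0")
  case True
  then show ?thesis
    using onorm_pos_le[OF bounded_linear_M] ip_nonneg by (simp add: norm_wrt_ip)
next
  case False
  have "((norm (M x))\<^sup>2)\<^sup>2 = (ip x (M x))\<^sup>2"
    unfolding ip_def using self_adjoint[of x "M x"] by (simp add: power2_norm_eq_inner)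
  also have "\<dots> \<le> ip x x * ip (M x) (M x)" by (rule ip_Cauchy_Schwarz)
  also have "\<dots> \<le> ip x x * (onorm M * (norm (M x))\<^sup>2)"
  proof (intro mult_left_mono ip_nonneg)
    have "ip (M x) (M x) \<le> norm (M x) * norm (M (M x))"
      unfolding ip_def by (rule norm_cauchy_schwarz)
    also have "\<dots> \<le> norm (M x) * (onorm M * norm (M x))"
      by (intro mult_left_mono onorm[OF bounded_linear_M]) simp
    finally show "ip (M x) (M x) \<le> onorm M * (norm (M x))\<^sup>2"
      by (simp add: power2_eq_square mult_ac)
  qed
  finally have "(norm (M x))\<^sup>2 * (norm (M x))\<^sup>2 \<le> (onorm M * ip x x) * (norm (M x))\<^sup>2"
    by (simp add: power2_eq_square mult_ac)
  then have "(norm (M x))\<^sup>2 \<le> onorm M * ip x x"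
    by (rule mult_right_le_imp_le) (use False in simp)
  then have "norm (M x) \<le> sqrt (onorm M * ip x x)" by (rule real_le_rsqrt)
  then show ?thesis by (simp add: norm_wrt_ip real_sqrt_mult)
qed

text \<open>The constant is the minimum of the form on the unit sphere. It serves only to carry
  convergence, boundedness and compactness between the form and the Euclidean norm and never enters
  the rate.\<close>

lemma coercive: obtains c where "0 < c" "\<And>x. c * (norm x)\<^sup>2 \<le> ip x x"
proof -
  let ?S = "sphere (0::'a) 1"
  have "continuous_on ?S (\<lambda>x. ip x x)"
    unfolding ip_def by (intro continuous_intros linear_continuous_on_compose[OF _ lin])
  moreover have "?S \<noteq> {}" by simp
  ultimately obtain m where m: "m \<in> ?S" "\<And>x. x \<in> ?S \<Longrightarrow> ip m m \<le> ip x x"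
    using continuous_attains_inf[OF compact_sphere] by blast
  have "ip m m * (norm x)\<^sup>2 \<le> ip x x" for x
  proof (cases "x = 0")
    case False
    then have "ip m m \<le> ip ((1 / norm x) *\<^sub>R x) ((1 / norm x) *\<^sub>R x)" by (intro m) simp
    then show ?thesis using False by (simp add: ip_simps field_simps power2_eq_square)
  qed (simp add: ip_simps)
  moreover have "0 < ip m m" using m(1) pos unfolding ip_def by (metis norm_zero dist_0_norm mem_sphere zero_neq_one)
  ultimately show ?thesis using that by blast
qed

lemma tendsto_ip_imp_tendsto:
  assumes "(\<lambda>k. ip (x k - p) (x k - p)) \<longlonglongrightarrow> 0"
  shows "x \<longlonglongrightarrow> p"
proof -
  obtain c where c: "0 < c" "\<And>x. c * (norm x)\<^sup>2 \<le> ip x x" using coercive by blast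
  have "(\<lambda>k. (norm (x k - p))\<^sup>2) \<longlonglongrightarrow> 0"
  proof (rule Lim_null_comparison)
    show "\<forall>\<^sub>F k in sequentially. norm ((norm (x k - p))\<^sup>2) \<le> ip (x k - p) (x k - p) / c"
      using c by (auto simp: field_simps)
    show "(\<lambda>k. ip (x k - p) (x k - p) / c) \<longlonglongrightarrow> 0"
      using tendsto_divide[OF assms tendsto_const, of c] c(1) by simp
  qed
  then have "(\<lambda>k. norm (x k - p)) \<longlonglongrightarrow> 0"
    using tendsto_real_sqrt by fastforce
  then show ?thesis using LIM_zero_cancel tendsto_norm_zero_iff by blast
qed

lemma bounded_if_ip_bounded:
  assumes "\<And>k. ip (x k - p) (x k - p) \<le> B"
  shows "bounded (range x)"
proof -
  obtain c where c: "0 < c" "\<And>x. c * (norm x)\<^sup>2 \<le> ip x x" using coercive by blast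
  have "dist p (x k) \<le> sqrt (B / c)" for k
  proof -
    have "c * (norm (x k - p))\<^sup>2 \<le> B" using c(2)[of "x k - p"] assms[of k] by linarith
    then show ?thesis using c(1) by (intro real_le_rsqrt) (simp add: field_simps dist_norm norm_minus_commute)
  qed
  then show ?thesis unfolding bounded_def by blast
qed

text \<open>A Euclidean ball about \<open>u\<close> contains every point that is at least as close
  to \<open>u\<close> in the form as a chosen \<open>s\<close>, so a minimiser exists by
  compactness. The inequality is its first-order condition along segments of
  \<open>S\<close>.\<close>

lemma projection_exists:
  assumes "closed S" "convex S" "S \<noteq> {}"
  obtains p where "p \<in> S" "\<And>z. z \<in> S \<Longrightarrow> ip (u - p) (z - p) \<le> 0"
proof -
  obtain c where c: "0 < c" "\<And>x. c * (norm x)\<^sup>2 \<le> ip x x" using coercive by blast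
  obtain s where s: "s \<in> S" using assms(3) by blast
  define K where "K = S \<inter> cball u (sqrt (ip (u - s) (u - s) / c))"
  have out: "z \<in> cball u (sqrt (ip (u - s) (u - s) / c))" if "ip (u - z) (u - z) \<le> ip (u - s) (u - s)" for z
  proof -
    have "c * (norm (u - z))\<^sup>2 \<le> ip (u - s) (u - s)" using c(2)[of "u - z"] that by linarith
    then show ?thesis using c(1) by (auto intro!: real_le_rsqrt simp: field_simps dist_norm)
  qed
  have "compact K" unfolding K_def using assms(1) by (intro closed_Int_compact compact_cball)
  moreover have sK: "s \<in> K" unfolding K_def using s out by simp
  moreover have "continuous_on K (\<lambda>z. ip (u - z) (u - z))"
    unfolding ip_def by (intro continuous_intros linear_continuous_on_compose[OF _ lin])
  ultimately obtain p where p: "p \<in> K" "\<And>z. z \<in> K \<Longrightarrow> ip (u - p) (u - p) \<le> ip (u - z) (u - z)"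
    using continuous_attains_inf[of K] by blast
  have min: "ip (u - p) (u - p) \<le> ip (u - z) (u - z)" if "z \<in> S" for z
    using p(2)[OF sK] p(2)[of z] out[of z] that unfolding K_def by fastforce
  have pS: "p \<in> S" using p(1) unfolding K_def by simp
  have "ip (u - p) (z - p) \<le> 0" if z: "z \<in> S" for z
  proof (rule ccontr)
    assume "\<not> ?thesis"
    then have a: "0 < ip (u - p) (z - p)" (is "0 < ?a") by simp
    let ?D = "ip (z - p) (z - p)"
    have le: "2 * ?a \<le> t * ?D" if t: "0 < t" "t \<le> 1" for t
    proof -
      have "(1 - t) *\<^sub>R p + t *\<^sub>R z \<in> S" using assms(2) pS z t by (intro convexD) auto
      from min[OF this] have "ip (u - p) (u - p)
          \<le> ip ((u - p) - t *\<^sub>R (z - p)) ((u - p) - t *\<^sub>R (z - p))" by (simp add: algebra_simps)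
      also have "\<dots> = ip (u - p) (u - p) - 2 * t * ?a + t * (t * ?D)"
        by (simp add: ip_simps ip_commute algebra_simps)
      finally have "t * (2 * ?a) \<le> t * (t * ?D)" by simp
      then show ?thesis using t by simp
    qed
    \<comment> \<open>So small that the second-order term \<open>t * ?D\<close> is at most
      \<open>?a\<close>; the \<open>+ 1\<close> keeps the denominator positive knowing only that
      \<open>?D\<close> is nonnegative.\<close>
    define t where "t = min 1 (?a / (?D + 1))"
    have D: "0 \<le> ?D" by (rule ip_nonneg)
    then have "0 < t" "t \<le> 1" unfolding t_def using a by auto
    from le[OF this] have "2 * ?a \<le> t * ?D" .
    also have "\<dots> \<le> ?a / (?D + 1) * ?D" unfolding t_def using D by (intro mult_right_mono) auto
    also have "\<dots> \<le> ?a" using a D by (simp add: field_simps)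
    finally show False using a by simp
  qed
  with pS show ?thesis using that by blast
qed

end

section \<open>The Halpern iteration of a nonexpansive map\<close>

text \<open>For \<open>(k + 1) * a k\<close> the recursion telescopes, and each late
  \<open>c k\<close> adds less than \<open>e / 2\<close>; dividing by \<open>k + 1\<close> leaves
  less than \<open>e\<close>. Only eventual upper bounds on \<open>c\<close> are asked for, since
  \<open>c\<close> will be controlled by a limsup and may be very negative.\<close>

lemma weighted_recursion_tendsto_0:
  fixes a c :: "nat \<Rightarrow> real"
  assumes a: "\<And>k. 0 \<le> a k"
    and rec: "\<And>k. (real k + 2) * a (Suc k) \<le> (real k + 1) * a k + c k"
    and c: "\<And>e. 0 < e \<Longrightarrow> \<forall>\<^sub>F k in sequentially. c k < e"
  shows "a \<longlonglongrightarrow> 0"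
proof (rule LIMSEQ_I)
  fix e :: real assume e: "0 < e"
  obtain K where K: "\<And>k. K \<le> k \<Longrightarrow> c k < e / 2"
    using c[of "e / 2"] e unfolding eventually_sequentially by auto
  have bound: "(real k + 1) * a k \<le> (real K + 1) * a K + e / 2 * (real k - real K)" if "K \<le> k" for k
    using that
  proof (induction k rule: dec_induct)
    case (step n)
    have "e / 2 * (real (Suc n) - real K) = e / 2 * (real n - real K) + e / 2"
      by (simp add: field_simps)
    moreover have "(real (Suc n) + 1) * a (Suc n) = (real n + 2) * a (Suc n)" by simp
    ultimately show ?case using rec[of n] K[of n] step by linarith
  qed simp
  obtain N where N: "2 * (real K + 1) * a K / e < real N" using reals_Archimedean2 by blast
  have "norm (a k - 0) < e" if k: "max K N \<le> k" for k
  proof -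
    have "2 * (real K + 1) * a K / e < real k" using N k by linarith
    then have "(real K + 1) * a K < e / 2 * real k" using e by (simp add: field_simps)
    moreover have "(real k + 1) * a k \<le> (real K + 1) * a K + e / 2 * (real k - real K)"
      using bound k by simp
    moreover have "e / 2 * (real k - real K) \<le> e / 2 * real k" using e by simp
    moreover have "(real k + 1) * e = e / 2 * real k + e / 2 * real k + e" by (simp add: field_simps)
    ultimately have "(real k + 1) * a k < (real k + 1) * e" using e by linarith
    then show ?thesis using a[of k] by (simp add: mult_less_cancel_left)
  qed
  then show "\<exists>no. \<forall>n\<ge>no. norm (a n - 0) < e" by blast
qed

locale halpern = pos_def_form M for M :: "'a::euclidean_space \<Rightarrow> 'a" +
  fixes F :: "'a \<Rightarrow> 'a" and w :: "nat \<Rightarrow> 'a"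
  assumes nonexp: "ip (F x - F y) (F x - F y) \<le> ip (x - y) (x - y)"
    and iter: "w (Suc k) = (1 / (real k + 2)) *\<^sub>R w 0 + ((real k + 1) / (real k + 2)) *\<^sub>R F (w k)"
begin

text \<open>The potential function inequality of Lieder's rate proof; the induction step uses nonexpansiveness only
  between consecutive iterates.\<close>

lemma residual_inequality:
  "real k * ip (w k - F (w k)) (w k - F (w k)) \<le> 2 * ip (w k - F (w k)) (w 0 - w k)"
proof (induction k)
  case (Suc k)
  define r q d where "r = w k - F (w k)" and "q = w (Suc k) - F (w (Suc k))"
    and "d = w (Suc k) - w k"
  have wS: "(real k + 2) *\<^sub>R w (Suc k) = w 0 + (real k + 1) *\<^sub>R F (w k)"
    unfolding iter by (simp add: scaleR_add_right)
  \<comment> \<open>This eliminates the anchor: induction hypothesis and claim now involve only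
    \<open>d\<close>, \<open>r\<close> and \<open>q\<close>, and the factors \<open>k + 2\<close>
    and \<open>k + 1\<close> cancel from them.\<close>
  have a: "w 0 - w k = (real k + 2) *\<^sub>R d + (real k + 1) *\<^sub>R r"
    using wS unfolding d_def r_def by (simp add: algebra_simps scaleR_2)
  have "w 0 - w (Suc k) = (w 0 - w k) - d" unfolding d_def by simp
  then have ad: "w 0 - w (Suc k) = (real k + 1) *\<^sub>R (d + r)"
    unfolding a by (simp add: algebra_simps scaleR_2)
  have "real k * ip r r \<le> 2 * ip r (w 0 - w k)" using Suc.IH unfolding r_def .
  then have "0 \<le> (real k + 2) * (2 * ip d r + ip r r)"
    unfolding a by (simp add: ip_simps ip_commute algebra_simps)
  then have IH: "0 \<le> 2 * ip d r + ip r r" by (simp add: zero_le_mult_iff)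
  \<comment> \<open>The vector \<open>d - (q - r)\<close> is the difference of the two images.
    Expanded, the inequality reads
    \<open>ip q q + (2 * ip d r + ip r r) \<le> 2 * ip q (d + r)\<close>, and \<open>IH\<close>
    discards the bracket.\<close>
  have "ip (d - (q - r)) (d - (q - r)) \<le> ip d d"
    using nonexp[of "w (Suc k)" "w k"] unfolding d_def q_def r_def by (simp add: algebra_simps)
  then have "ip q q \<le> 2 * ip q (d + r)"
    using IH by (simp add: ip_simps ip_commute)
  then have "(real k + 1) * ip q q \<le> (real k + 1) * (2 * ip q (d + r))"
    by (intro mult_left_mono) auto
  also have "\<dots> = 2 * ip q (w 0 - w (Suc k))" unfolding ad by (simp add: ip_simps)
  finally show ?case unfolding q_def by (simp add: add.commute)
qed (simp add: ip_simps)

text \<open>Nonexpansiveness towards \<open>p\<close> gives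
  \<open>ip r r \<le> 2 * ip r (w k - p)\<close>. Added to the potential inequality it replaces
  \<open>w k\<close> by \<open>p\<close> and raises the factor \<open>k\<close> to
  \<open>k + 1\<close>; Cauchy-Schwarz then yields the bound.\<close>

lemma residual_rate:
  assumes p: "F p = p"
  shows "norm_wrt M (w k - F (w k)) \<le> 2 / (real k + 1) * norm_wrt M (w 0 - p)"
proof -
  define r where "r = w k - F (w k)"
  have "ip (w k - p - r) (w k - p - r) \<le> ip (w k - p) (w k - p)"
    using nonexp[of "w k" p] unfolding r_def p by (simp add: algebra_simps)
  then have "ip r r \<le> 2 * ip r (w k - p)"
    by (simp add: ip_simps ip_commute)
  moreover have "real k * ip r r \<le> 2 * ip r (w 0 - w k)"
    using residual_inequality unfolding r_def .
  ultimately have le: "(real k + 1) * ip r r \<le> 2 * ip r (w 0 - p)"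
    by (simp add: ip_simps ip_commute algebra_simps)
  have "ip r (w 0 - p) \<le> sqrt (ip r r) * sqrt (ip (w 0 - p) (w 0 - p))"
    using real_le_rsqrt[OF ip_Cauchy_Schwarz[of r "w 0 - p"]] by (simp add: real_sqrt_mult)
  with le have *: "sqrt (ip r r) * ((real k + 1) * sqrt (ip r r))
      \<le> sqrt (ip r r) * (2 * sqrt (ip (w 0 - p) (w 0 - p)))"
    using ip_nonneg[of r] by (simp add: mult.left_commute)
  have "(real k + 1) * sqrt (ip r r) \<le> 2 * sqrt (ip (w 0 - p) (w 0 - p))"
  proof (cases "sqrt (ip r r) = 0")
    case False
    then have "0 < sqrt (ip r r)" using ip_nonneg[of r] by simp
    with * show ?thesis using mult_le_cancel_left_pos by blast
  qed (simp add: ip_nonneg)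
  then show ?thesis unfolding norm_wrt_ip r_def[symmetric] by (simp add: field_simps)
qed

lemma residual_tendsto_0:
  assumes p: "F p = p"
  shows "(\<lambda>k. w k - F (w k)) \<longlonglongrightarrow> 0"
proof -
  let ?D = "norm_wrt M (w 0 - p)"
  have "(\<lambda>k. norm_wrt M (w k - F (w k))) \<longlonglongrightarrow> 0"
  proof (rule Lim_null_comparison)
    show "\<forall>\<^sub>F k in sequentially. norm (norm_wrt M (w k - F (w k))) \<le> 2 * ?D / real (Suc k)"
      using residual_rate[OF p] ip_nonneg by (simp add: norm_wrt_ip add.commute)
    show "(\<lambda>k. 2 * ?D / real (Suc k)) \<longlonglongrightarrow> 0"
      by (rule LIMSEQ_Suc) (rule lim_const_over_n)
  qed
  from tendsto_power[OF this, of 2]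
  have "(\<lambda>k. ip (w k - F (w k) - 0) (w k - F (w k) - 0)) \<longlonglongrightarrow> 0"
    by (simp add: norm_wrt_ip ip_nonneg)
  then show ?thesis by (rule tendsto_ip_imp_tendsto)
qed

text \<open>Both averaged points, \<open>w 0\<close> and \<open>F (w k)\<close>, lie in the ball of
  the form about \<open>p\<close> through \<open>w 0\<close>.\<close>

lemma iterates_bounded:
  assumes p: "F p = p"
  shows "ip (w k - p) (w k - p) \<le> ip (w 0 - p) (w 0 - p)"
proof (induction k)
  case (Suc k)
  let ?B = "ip (w 0 - p) (w 0 - p)"
  define l where "l = 1 / (real k + 2)"
  have l: "0 \<le> l" "l \<le> 1" "(real k + 1) / (real k + 2) = 1 - l" unfolding l_def by (auto simp: field_simps)
  let ?u = "w 0 - p" and ?v = "F (w k) - p"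
  have v: "ip ?v ?v \<le> ?B" using nonexp[of "w k" p] Suc p by simp
  have "w (Suc k) - p = l *\<^sub>R ?u + (1 - l) *\<^sub>R ?v"
    unfolding iter l(3) unfolding l_def[symmetric] by (simp add: algebra_simps)
  then have "ip (w (Suc k) - p) (w (Suc k) - p)
      = l * ip ?u ?u + (1 - l) * ip ?v ?v - l * (1 - l) * ip (?u - ?v) (?u - ?v)"
    by (simp only: ip_convex_combination)
  also have "\<dots> \<le> l * ?B + (1 - l) * ?B"
    using mult_left_mono[OF v, of "1 - l"] l mult_nonneg_nonneg[of "l * (1 - l)", OF _ ip_nonneg[of "?u - ?v"]]
    by simp
  finally show ?case by (simp add: algebra_simps)
qed simp

lemma F_tendsto:
  assumes "x \<longlonglongrightarrow> q" shows "(\<lambda>k. F (x k)) \<longlonglongrightarrow> F q"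
proof (rule tendsto_ip_imp_tendsto)
  have "(\<lambda>k. ip (x k - q) (x k - q)) \<longlonglongrightarrow> ip (q - q) (q - q)"
    using assms by (intro tendsto_ip tendsto_intros)
  then have "(\<lambda>k. ip (x k - q) (x k - q)) \<longlonglongrightarrow> 0" by (simp add: ip_simps)
  then show "(\<lambda>k. ip (F (x k) - F q) (F (x k) - F q)) \<longlonglongrightarrow> 0"
    by (rule Lim_null_comparison[rotated]) (simp add: ip_nonneg nonexp)
qed

lemma closed_fixed_points: "closed {x. F x = x}"
  unfolding closed_sequential_limits
proof (intro allI impI, elim conjE)
  fix x q assume x: "\<forall>n. x n \<in> {x. F x = x}" "x \<longlonglongrightarrow> q"
  then have "x \<longlonglongrightarrow> F q" using F_tendsto[OF x(2)] by simp
  then show "q \<in> {x. F x = x}" using LIMSEQ_unique x(2) by blast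
qed

text \<open>The image of \<open>z\<close> is no farther from \<open>x\<close> and from
  \<open>y\<close> than \<open>z\<close> itself, and those two distances add up to the distance from
  \<open>x\<close> to \<open>y\<close>; strict convexity of the norm leaves only
  \<open>z\<close>.\<close>

lemma convex_fixed_points: "convex {x. F x = x}"
proof (rule convexI)
  fix x y and s t :: real
  assume x: "x \<in> {x. F x = x}" and y: "y \<in> {x. F x = x}" and st: "0 \<le> s" "0 \<le> t" "s + t = 1"
  have s: "s = 1 - t" using st by simp
  define z where "z = s *\<^sub>R x + t *\<^sub>R y"
  define D where "D = ip (x - y) (x - y)"
  have zx: "z - x = (- t) *\<^sub>R (x - y)" and zy: "z - y = s *\<^sub>R (x - y)"
    unfolding z_def s by (simp_all add: algebra_simps)
  have X: "ip (F z - x) (F z - x) \<le> t\<^sup>2 * D" and Y: "ip (F z - y) (F z - y) \<le> s\<^sup>2 * D"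
    using nonexp[of z x] nonexp[of z y] x y unfolding zx zy D_def
    by (simp_all add: ip_simps(5-8) power2_eq_square mult.assoc)
  have "F z - z = s *\<^sub>R (F z - x) + t *\<^sub>R (F z - y)"
    unfolding z_def s by (simp add: algebra_simps)
  moreover have "x - y = (F z - y) - (F z - x)" by simp
  ultimately have "ip (F z - z) (F z - z)
      = s * ip (F z - x) (F z - x) + t * ip (F z - y) (F z - y) - s * t * D"
    unfolding D_def s
    using ip_convex_combination[of "1 - t" "F z - x" "F z - y"] ip_minus_commute[of "F z - x" "F z - y"]
    by simp
  also have "\<dots> \<le> s * (t\<^sup>2 * D) + t * (s\<^sup>2 * D) - s * t * D"
    using X Y st by (intro diff_right_mono add_mono mult_left_mono) auto
  also have "\<dots> = 0" unfolding s by (simp add: algebra_simps power2_eq_square)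
  finally show "s *\<^sub>R x + t *\<^sub>R y \<in> {x. F x = x}"
    unfolding z_def[symmetric] by (simp add: ip_eq_0)
qed

text \<open>Wittmann's argument: the limit is the projection \<open>p\<close> of the anchor \<open>w 0\<close> onto the fixed points,
  because every cluster point of \<open>w\<close> is a fixed point and so
  \<open>limsup \<langle>w 0 - p, w k - p\<rangle> \<le> 0\<close>.\<close>

lemma convergence:
  assumes "F q = q"
  obtains p where "F p = p" "w \<longlonglongrightarrow> p"
proof -
  obtain p where p: "F p = p" and proj: "\<And>z. F z = z \<Longrightarrow> ip (w 0 - p) (z - p) \<le> 0"
    using projection_exists[OF closed_fixed_points convex_fixed_points, of "w 0"] assms by auto
  have ev: "\<forall>\<^sub>F k in sequentially. ip (w 0 - p) (w k - p) < e" if e: "0 < e" for e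
  proof (rule ccontr)
    assume "\<not> ?thesis"
    then have "\<exists>\<^sub>F k in sequentially. e \<le> ip (w 0 - p) (w k - p)"
      by (simp add: not_eventually not_less)
    then obtain r :: "nat \<Rightarrow> nat" where r: "strict_mono r" "\<And>k. e \<le> ip (w 0 - p) (w (r k) - p)"
      using infinite_enumerate unfolding frequently_cofinite cofinite_eq_sequentially[symmetric]
      by (metis (no_types, lifting) mem_Collect_eq)
    have "bounded (range (w \<circ> r))"
      using bounded_if_ip_bounded[OF iterates_bounded[OF p]]
      by (rule bounded_subset) auto
    then obtain z s where s: "strict_mono s" "((w \<circ> r) \<circ> s) \<longlonglongrightarrow> z"
      using bounded_imp_convergent_subsequence by blast
    have lim: "(\<lambda>k. w (r (s k))) \<longlonglongrightarrow> z" using s(2) by (simp add: comp_def)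
    have "((\<lambda>k. w k - F (w k)) \<circ> (r \<circ> s)) \<longlonglongrightarrow> 0"
      using residual_tendsto_0[OF p] strict_mono_o[OF r(1) s(1)] by (rule LIMSEQ_subseq_LIMSEQ)
    then have "(\<lambda>k. w (r (s k)) - F (w (r (s k)))) \<longlonglongrightarrow> 0" by (simp add: comp_def)
    moreover have "(\<lambda>k. w (r (s k)) - F (w (r (s k)))) \<longlonglongrightarrow> z - F z"
      by (intro tendsto_diff lim F_tendsto)
    ultimately have "F z = z" using LIMSEQ_unique by fastforce
    then have "ip (w 0 - p) (z - p) \<le> 0" by (rule proj)
    moreover have "(\<lambda>k. ip (w 0 - p) (w (r (s k)) - p)) \<longlonglongrightarrow> ip (w 0 - p) (z - p)"
      by (intro tendsto_ip tendsto_intros lim)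
    then have "e \<le> ip (w 0 - p) (z - p)"
      by (rule LIMSEQ_le_const) (use r(2) in blast)
    ultimately show False using e by simp
  qed
  have "(\<lambda>k. ip (w k - p) (w k - p)) \<longlonglongrightarrow> 0"
  proof (rule weighted_recursion_tendsto_0[where c = "\<lambda>k. 2 * ip (w 0 - p) (w (Suc k) - p)"])
    fix k
    let ?a = "ip (w k - p) (w k - p)"
    define u v x where "u = w 0 - p" and "v = F (w k) - p" and "x = w (Suc k) - p"
    have "(real k + 2) *\<^sub>R w (Suc k) = w 0 + (real k + 1) *\<^sub>R F (w k)"
      unfolding iter by (simp add: scaleR_add_right)
    then have x: "(real k + 2) *\<^sub>R x = u + (real k + 1) *\<^sub>R v"
      unfolding u_def v_def x_def by (simp add: algebra_simps scaleR_2)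
    have "(real k + 1) * ip v v \<le> (real k + 1) * ?a"
      using nonexp[of "w k" p] p unfolding v_def by (intro mult_left_mono) auto
    moreover have "(real k + 2) * ip x x \<le> (real k + 1) * ip v v + 2 * ip u x"
    proof -
      have u: "u = (real k + 2) *\<^sub>R x - (real k + 1) *\<^sub>R v" using x by simp
      \<comment> \<open>With \<open>u\<close> eliminated by the iteration rule, the slack of the
        recursion is a sum of squares.\<close>
      have "2 * ip u x - (real k + 2) * ip x x + (real k + 1) * ip v v
          = (real k + 1) * ip (x - v) (x - v) + ip x x"
        unfolding u by (simp add: ip_simps ip_commute algebra_simps)
      moreover have "0 \<le> (real k + 1) * ip (x - v) (x - v) + ip x x"
        by (simp add: ip_nonneg)
      ultimately show ?thesis by linarith
    qed
    ultimately show "(real k + 2) * ip (w (Suc k) - p) (w (Suc k) - p)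
        \<le> (real k + 1) * ?a + 2 * ip (w 0 - p) (w (Suc k) - p)"
      unfolding u_def[symmetric] x_def[symmetric]
      by linarith
  next
    fix e :: real assume "0 < e"
    then have "\<forall>\<^sub>F k in sequentially. ip (w 0 - p) (w k - p) < e / 2" by (intro ev) simp
    then have "\<forall>\<^sub>F k in sequentially. ip (w 0 - p) (w (Suc k) - p) < e / 2"
      by (rule eventually_sequentially_Suc[THEN iffD2])
    then show "\<forall>\<^sub>F k in sequentially. 2 * ip (w 0 - p) (w (Suc k) - p) < e"
      by (rule eventually_mono) simp
  qed (rule ip_nonneg)
  then have "w \<longlonglongrightarrow> p" by (rule tendsto_ip_imp_tendsto)
  with p show ?thesis using that by blast
qed

end

section \<open>Symmetric matrices\<close>

lemma inner_matrix_vector: "x \<bullet> (transpose B *v y) = (B *v x) \<bullet> (y :: real^'m)"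
  for B :: "real^'n^'m"
  by (metis dot_lmul_matrix inner_commute transpose_matrix_vector)

lemma inner_symmetric_matrix:
  fixes S :: "real^'n^'n"
  assumes "transpose S = S"
  shows "(S *v x) \<bullet> y = x \<bullet> (S *v y)"
  using inner_matrix_vector[of x S y] assms by simp

text \<open>A minimiser \<open>v\<close> of the form on the unit sphere is perturbed along
  \<open>u = S *v v - l *\<^sub>R v\<close>. The first-order change of the shifted form is
  \<open>2 * (u \<bullet> u)\<close> times the step, which minimality allows only for
  \<open>u = 0\<close>.\<close>

lemma eigenvector_minimizes_Rayleigh:
  fixes S :: "real^'n^'n"
  assumes sym: "transpose S = S"
  obtains l v where "v \<noteq> 0" "S *v v = l *\<^sub>R v" "\<And>x. l * (x \<bullet> x) \<le> x \<bullet> (S *v x)"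
proof -
  have "continuous_on (sphere 0 1) (\<lambda>x. x \<bullet> (S *v x))"
    by (intro continuous_intros matrix_vector_mult_linear_continuous_on)
  moreover have "sphere (0::real^'n) 1 \<noteq> {}" by simp
  ultimately obtain v where v: "v \<in> sphere 0 1"
      and min: "\<And>x. x \<in> sphere 0 1 \<Longrightarrow> v \<bullet> (S *v v) \<le> x \<bullet> (S *v x)"
    using continuous_attains_inf[OF compact_sphere] by blast
  define l where "l = v \<bullet> (S *v v)"
  have vv: "v \<bullet> v = 1" using v by (simp add: norm_eq_1)
  have ray: "l * (x \<bullet> x) \<le> x \<bullet> (S *v x)" for x
  proof (cases "x = 0")
    case False
    then have "l \<le> ((1 / norm x) *\<^sub>R x) \<bullet> (S *v ((1 / norm x) *\<^sub>R x))"
      unfolding l_def by (intro min) simp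
    also have "\<dots> = x \<bullet> (S *v x) / (x \<bullet> x)"
      by (simp add: matrix_vector_mult_scaleR power2_norm_eq_inner[symmetric] power2_eq_square)
    finally show ?thesis using False by (simp add: field_simps)
  qed simp
  define u where "u = S *v v - l *\<^sub>R v"
  have quad: "0 \<le> t * (2 * (u \<bullet> u) + t * (u \<bullet> (S *v u) - l * (u \<bullet> u)))" for t
  proof -
    have "(S *v u) \<bullet> v = u \<bullet> (S *v v)" by (rule inner_symmetric_matrix[OF sym])
    then have "(v + t *\<^sub>R u) \<bullet> (S *v (v + t *\<^sub>R u)) - l * ((v + t *\<^sub>R u) \<bullet> (v + t *\<^sub>R u))
        = (v \<bullet> (S *v v) - l * (v \<bullet> v)) + t * (2 * (u \<bullet> (S *v v - l *\<^sub>R v))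
          + t * (u \<bullet> (S *v u) - l * (u \<bullet> u)))"
      by (simp add: matrix_vector_mult_scaleR matrix_vector_right_distrib inner_simps
          inner_commute algebra_simps)
    then show ?thesis using ray[of "v + t *\<^sub>R u"] vv unfolding l_def[symmetric] u_def[symmetric] by simp
  qed
  define C where "C = u \<bullet> (S *v u) - l * (u \<bullet> u)"
  have C: "0 \<le> C" using ray[of u] unfolding C_def by simp
  have "u = 0"
  proof (rule ccontr)
    assume "u \<noteq> 0"
    then have a: "0 < u \<bullet> u" by simp
    \<comment> \<open>A negative step whose second-order effect \<open>- (t * C)\<close> stays below
      \<open>u \<bullet> u\<close>, half of the first-order one.\<close>
    define t where "t = - (u \<bullet> u) / (C + 1)"
    have "t < 0" unfolding t_def using a C by (simp add: divide_neg_pos)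
    with quad[of t] have "2 * (u \<bullet> u) + t * C \<le> 0" unfolding C_def by (simp add: zero_le_mult_iff)
    moreover have "- (t * C) \<le> u \<bullet> u" unfolding t_def using a C by (simp add: field_simps)
    ultimately show False using a by linarith
  qed
  then show ?thesis using that[of v l] ray vv unfolding u_def by force
qed

text \<open>Needed because \<open>Min\<close> in \<open>lambda_min\<close> is meaningful only on a
  finite set. Eigenvectors of distinct eigenvalues are orthogonal, hence independent.\<close>

lemma finite_eigenvalues_symmetric:
  fixes S :: "real^'n^'n"
  assumes sym: "transpose S = S"
  shows "finite {l. \<exists>v. v \<noteq> 0 \<and> S *v v = l *\<^sub>R v}"
proof -
  let ?L = "{l. \<exists>v. v \<noteq> 0 \<and> S *v v = l *\<^sub>R v}"
  obtain e where e: "\<And>l. l \<in> ?L \<Longrightarrow> e l \<noteq> 0 \<and> S *v e l = l *\<^sub>R e l"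
    using bchoice[of ?L "\<lambda>l v. v \<noteq> 0 \<and> S *v v = l *\<^sub>R v"] by auto
  have orth: "e l \<bullet> e k = 0" if "l \<in> ?L" "k \<in> ?L" "l \<noteq> k" for l k
  proof -
    have "l * (e l \<bullet> e k) = k * (e l \<bullet> e k)"
      using inner_symmetric_matrix[OF sym, of "e l" "e k"] e[OF that(1)] e[OF that(2)] by simp
    then show ?thesis using that(3) by simp
  qed
  have inj: "inj_on e ?L"
    using orth e by (metis (no_types, lifting) inj_onI inner_eq_zero_iff)
  have "pairwise orthogonal (e ` ?L)"
    using orth by (auto simp: pairwise_def orthogonal_def)
  moreover have "0 \<notin> e ` ?L" using e by force
  ultimately have "finite (e ` ?L)"
    using pairwise_orthogonal_independent independent_imp_finite by blast
  then show ?thesis using inj finite_imageD by blast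
qed

text \<open>The minimum of the Rayleigh quotient is an eigenvalue, so \<open>lambda_min S\<close>
  lies below it; positivity comes from testing the form with an eigenvector of
  \<open>lambda_min S\<close>.\<close>

lemma
  fixes S :: "real^'n^'n"
  assumes S: "pos_def S"
  shows lambda_min_pos: "0 < lambda_min S"
    and lambda_min_Rayleigh: "lambda_min S * (norm x)\<^sup>2 \<le> x \<bullet> (S *v x)"
proof -
  let ?L = "{l. \<exists>v. v \<noteq> 0 \<and> S *v v = l *\<^sub>R v}"
  have sym: "transpose S = S" and pos: "\<And>v. v \<noteq> 0 \<Longrightarrow> 0 < v \<bullet> (S *v v)"
    using S unfolding pos_def_def by auto
  obtain l v where l: "v \<noteq> 0" "S *v v = l *\<^sub>R v" "\<And>x. l * (x \<bullet> x) \<le> x \<bullet> (S *v x)"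
    using eigenvector_minimizes_Rayleigh[OF sym] by blast
  then have lL: "l \<in> ?L" by blast
  have le: "lambda_min S \<le> l"
    unfolding lambda_min_def by (rule Min_le[OF finite_eigenvalues_symmetric[OF sym] lL])
  have "lambda_min S \<in> ?L"
    unfolding lambda_min_def using lL by (intro Min_in finite_eigenvalues_symmetric[OF sym]) blast
  then obtain u where "u \<noteq> 0" "S *v u = lambda_min S *\<^sub>R u" by blast
  then show "0 < lambda_min S" using pos[of u] by (simp add: zero_less_mult_iff)
      (metis inner_gt_zero_iff less_asym)
  show "lambda_min S * (norm x)\<^sup>2 \<le> x \<bullet> (S *v x)"
    using mult_right_mono[OF le, of "x \<bullet> x"] l(3)[of x] by (simp add: power2_norm_eq_inner)
qed

lemma pos_def_matrix_inv:
  fixes Q :: "real^'m^'m"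
  assumes "pos_def Q"
  shows "Q *v (matrix_inv Q *v y) = y"
proof -
  have "inj ((*v) Q)"
  proof (rule injI)
    fix x y assume "Q *v x = Q *v y"
    then have "Q *v (x - y) = 0" by (simp add: matrix_vector_mult_diff_distrib)
    then show "x = y" using assms unfolding pos_def_def by (metis eq_iff_diff_eq_0 inner_zero_right less_irrefl)
  qed
  then have "invertible Q" by (metis invertible_left_inverse matrix_left_invertible_injective)
  then have "Q ** matrix_inv Q = mat 1"
    using someI_ex[of "\<lambda>A'. Q ** A' = mat 1 \<and> A' ** Q = mat 1"]
    unfolding invertible_def matrix_inv_def by blast
  then show ?thesis by (simp add: matrix_vector_mul_assoc)
qed

section \<open>The preconditioner\<close>

locale preconditioner =
  fixes A :: "real^'n^'m" and P :: "real^'n^'n" and Q :: "real^'m^'m" and \<mu> :: real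
  assumes P: "transpose P = P"
    and Q: "pos_def Q"
    and S: "pos_def (P - transpose A ** matrix_inv Q ** A)"
    and \<mu>: "\<mu> = lambda_min (P - transpose A ** matrix_inv Q ** A)"
begin

abbreviation "M \<equiv> M_map P Q A"

lemma Q_sym: "transpose Q = Q" using Q unfolding pos_def_def by blast

lemma Q_nonneg: "0 \<le> v \<bullet> (Q *v v)"
  using Q unfolding pos_def_def by (cases "v = 0") (auto simp: less_imp_le)

lemma \<mu>_pos: "0 < \<mu>" unfolding \<mu> by (rule lambda_min_pos[OF S])

lemma Schur_lower:
  "\<mu> * (norm x)\<^sup>2 \<le> x \<bullet> (P *v x) - (A *v x) \<bullet> (matrix_inv Q *v (A *v x))"
  using lambda_min_Rayleigh[OF S, of x] unfolding \<mu>[symmetric]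
  by (simp add: matrix_vector_mult_diff_rdistrib inner_diff_right matrix_vector_mul_assoc[symmetric]
      inner_matrix_vector del: transpose_matrix_vector)

text \<open>\<open>P\<close> exceeds its Schur complement by a positive semidefinite matrix. This is
  the strong convexity of the subproblem behind \<open>T_lin\<close>.\<close>

lemma P_lower: "\<mu> * (norm x)\<^sup>2 \<le> x \<bullet> (P *v x)"
  using Schur_lower[of x] Q_nonneg[of "matrix_inv Q *v (A *v x)"]
  by (simp add: pos_def_matrix_inv[OF Q] inner_commute)

text \<open>Completing the square in \<open>y\<close>: the vector \<open>v\<close> vanishes at the
  minimising \<open>y\<close>, where only the Schur complement remains.\<close>

lemma M_quadratic:
  fixes x :: "real^'n" and y :: "real^'m"
  defines "v \<equiv> y + matrix_inv Q *v (A *v x)"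
  shows "(x, y) \<bullet> M (x, y) = (x \<bullet> (P *v x) - (A *v x) \<bullet> (matrix_inv Q *v (A *v x))) + v \<bullet> (Q *v v)"
proof -
  let ?q = "matrix_inv Q *v (A *v x)"
  have "?q \<bullet> (Q *v y) = (A *v x) \<bullet> y"
    using inner_symmetric_matrix[OF Q_sym, of ?q y] by (simp add: pos_def_matrix_inv[OF Q])
  then show ?thesis unfolding v_def M_map_def
    by (simp add: matrix_vector_right_distrib pos_def_matrix_inv[OF Q] inner_simps
        inner_matrix_vector inner_commute del: transpose_matrix_vector)
qed

lemma M_lower: "\<mu> * (norm (fst z))\<^sup>2 \<le> z \<bullet> M z"
proof -
  obtain x y where z: "z = (x, y)" by (cases z)
  show ?thesis unfolding z M_quadratic using Schur_lower[of x] Q_nonneg by (simp add: add_increasing2)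
qed

sublocale pos_def_form M
proof (rule pos_def_form.intro)
  show "linear M"
    by (rule linearI) (auto simp: M_map_def matrix_vector_right_distrib matrix_vector_mult_scaleR algebra_simps
        simp del: transpose_matrix_vector)
  show "M x \<bullet> y = x \<bullet> M y" for x y
  proof (cases x, cases y)
    fix a b c d assume xy: "x = (a, b)" "y = (c, d)"
    show ?thesis unfolding xy M_map_def
      using inner_matrix_vector[of c A b] inner_matrix_vector[of a A d]
        inner_symmetric_matrix[OF P, of a c] inner_symmetric_matrix[OF Q_sym, of b d]
      by (simp add: inner_simps inner_commute)
  qed
  show "0 < x \<bullet> M x" if "x \<noteq> 0" for x
  proof (cases x)
    case (Pair a b)
    show ?thesis
    proof (cases "a = 0")
      case True
      then have "b \<noteq> 0" using that Pair by (simp add: zero_prod_def)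
      then show ?thesis using Q True unfolding Pair M_map_def pos_def_def by simp
    next
      case False
      then have "0 < \<mu> * (norm (fst x))\<^sup>2" using \<mu>_pos Pair by simp
      then show ?thesis using M_lower[of x] by linarith
    qed
  qed
qed

lemma norm_fst_le_norm_wrt: "norm (fst z) \<le> norm_wrt M z / sqrt \<mu>"
proof -
  have "(norm (fst z))\<^sup>2 \<le> ip z z / \<mu>"
    using M_lower[of z] \<mu>_pos unfolding ip_def by (simp add: field_simps)
  then have "norm (fst z) \<le> sqrt (ip z z / \<mu>)" by (rule real_le_rsqrt)
  then show ?thesis by (simp add: norm_wrt_ip real_sqrt_divide)
qed

end

section \<open>The linearized proximal iteration\<close>

locale linearized_proximal = preconditioner A P Q \<mu>
  for A :: "real^'n^'m" and P :: "real^'n^'n" and Q :: "real^'m^'m" and \<mu> :: real +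
  fixes b :: "real^'m" and \<sigma> :: real and f h :: "real^'n \<Rightarrow> real" and g :: "real^'n \<Rightarrow> ereal"
    and L :: real
  assumes convex_f: "convex_on UNIV f" and f: "cont_differentiable f"
    and g: "proper_closed_convex g"
    and convex_h: "convex_on UNIV h" and h: "cont_differentiable h"
    and lipschitz_h: "L-lipschitz_on UNIV (grad h)"
    and convex_\<phi>: "convex_on UNIV (\<lambda>x. f x - h x + \<sigma> / 2 * (norm (A *v x - b))\<^sup>2)"
    and zeros: "set_inverse (T_map A b \<sigma> f g) 0 \<noteq> {}"
begin

abbreviation "zer \<equiv> set_inverse (T_map A b \<sigma> f g) 0"
abbreviation "T \<equiv> T_lin P Q A b \<sigma> f g h"

definition "\<phi> x = f x - h x + \<sigma> / 2 * (norm (A *v x - b))\<^sup>2"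
definition "D\<phi> x = grad f x - grad h x + \<sigma> *\<^sub>R (transpose A *v (A *v x - b))"

lemma L_nonneg: "0 \<le> L" using lipschitz_h by (rule lipschitz_on_nonneg)

lemma GDERIV_f: "GDERIV f x :> grad f x" and GDERIV_h: "GDERIV h x :> grad h x"
  using f h unfolding cont_differentiable_def by (auto intro: GDERIV_grad)

lemma GDERIV_\<phi>: "GDERIV \<phi> x :> D\<phi> x"
proof -
  have "((\<lambda>x. A *v x) has_derivative (\<lambda>v. A *v v)) (at x)"
    by (rule bounded_linear_imp_has_derivative) simp
  then have N: "((\<lambda>x. (A *v x - b) \<bullet> (A *v x - b)) has_derivative (\<lambda>v. 2 * ((A *v x - b) \<bullet> (A *v v)))) (at x)"
    by (auto intro!: derivative_eq_intros simp: inner_commute)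
  have "(\<phi> has_derivative (\<lambda>v. v \<bullet> grad f x - v \<bullet> grad h x + \<sigma> / 2 * (2 * ((A *v x - b) \<bullet> (A *v v))))) (at x)"
    unfolding \<phi>_def power2_norm_eq_inner
    by (intro has_derivative_add has_derivative_diff has_derivative_mult_right N
        GDERIV_f[unfolded gderiv_def] GDERIV_h[unfolded gderiv_def])
  then show ?thesis
    unfolding gderiv_def D\<phi>_def
    by (simp add: inner_add_right inner_diff_right[of _ "grad f x" "grad h x"] inner_matrix_vector
        inner_commute[of "A *v _" "A *v x - b"] del: transpose_matrix_vector)
qed

lemma convex_\<phi>': "convex_on UNIV \<phi>" using convex_\<phi> unfolding \<phi>_def .

section \<open>Monotonicity of \<open>A_map\<close> and the resolvent\<close>

lemma A_map_iff:
  "a \<in> A_map A b \<sigma> f g h z \<longleftrightarrow>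
    (\<exists>s \<in> subdifferential g (fst z). a = (s + D\<phi> (fst z) - transpose A *v snd z, A *v fst z - b))"
  unfolding A_map_def D\<phi>_def by (cases z) (auto simp: algebra_simps)

text \<open>Up to a constant, \<open>A_map\<close> is the sum of the subdifferential of
  \<open>g\<close>, the gradient of the convex \<open>\<phi>\<close> and a skew linear map; the skew
  part cancels in the inner product.\<close>

lemma A_map_mono:
  assumes "a \<in> A_map A b \<sigma> f g h z" "a' \<in> A_map A b \<sigma> f g h z'"
  shows "0 \<le> (a - a') \<bullet> (z - z')"
proof -
  obtain s s' where s: "s \<in> subdifferential g (fst z)" "s' \<in> subdifferential g (fst z')"
    and a: "a = (s + D\<phi> (fst z) - transpose A *v snd z, A *v fst z - b)"
      "a' = (s' + D\<phi> (fst z') - transpose A *v snd z', A *v fst z' - b)"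
    using assms unfolding A_map_iff by blast
  define x y where "x = fst z - fst z'" and "y = snd z - snd z'"
  have "a - a' = ((s - s') + (D\<phi> (fst z) - D\<phi> (fst z')) - transpose A *v y, A *v x)"
    unfolding a x_def y_def by (simp add: matrix_vector_mult_diff_distrib algebra_simps
        del: transpose_matrix_vector)
  moreover have "z - z' = (x, y)" unfolding x_def y_def by (simp add: prod_eq_iff)
  ultimately have "(a - a') \<bullet> (z - z')
      = (s - s') \<bullet> x + (D\<phi> (fst z) - D\<phi> (fst z')) \<bullet> x - x \<bullet> (transpose A *v y) + (A *v x) \<bullet> y"
    by (simp add: inner_add_left inner_diff_left[of "_ + _"] inner_commute[of x "transpose A *v y"]
        del: transpose_matrix_vector)
  moreover have "0 \<le> (s - s') \<bullet> x"
    unfolding x_def by (rule subdifferential_mono[OF g s])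
  moreover have "0 \<le> (D\<phi> (fst z) - D\<phi> (fst z')) \<bullet> x"
    unfolding x_def by (rule convex_on_gradient_mono[OF convex_\<phi>' GDERIV_\<phi> GDERIV_\<phi>])
  ultimately show ?thesis unfolding inner_matrix_vector by simp
qed

lemma T_iff: "z \<in> T w \<longleftrightarrow> M (w - z) - (grad h (fst w), 0) \<in> A_map A b \<sigma> f g h z"
proof -
  have "z \<in> T w \<longleftrightarrow> (\<exists>a \<in> A_map A b \<sigma> f g h z. M w - (grad h (fst w), 0) = M z + a)"
    unfolding T_lin_def set_inverse_def B_map_def by (cases w) auto
  also have "\<dots> \<longleftrightarrow> (\<exists>a \<in> A_map A b \<sigma> f g h z. M (w - z) - (grad h (fst w), 0) = a)"
    by (intro bex_cong refl) (auto simp: linear_diff[OF lin] algebra_simps)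
  finally show ?thesis by simp
qed

text \<open>Monotonicity of \<open>A_map\<close> at the two outputs. For constant
  \<open>grad h\<close> this is firm nonexpansiveness in \<open>ip\<close>; the explicit gradient
  step adds the cross term on the left, evaluated at the inputs.\<close>

lemma T_firm:
  assumes "z \<in> T w" "z' \<in> T w'"
  shows "(fst z - fst z') \<bullet> (grad h (fst w) - grad h (fst w'))
    \<le> ip (z - z') ((w - w') - (z - z'))"
proof -
  have "0 \<le> ((M (w - z) - (grad h (fst w), 0)) - (M (w' - z') - (grad h (fst w'), 0))) \<bullet> (z - z')"
    using assms unfolding T_iff by (rule A_map_mono)
  also have "(M (w - z) - (grad h (fst w), 0)) - (M (w' - z') - (grad h (fst w'), 0))
      = M ((w - w') - (z - z')) - (grad h (fst w) - grad h (fst w'), 0)"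
    by (simp only: linear_diff[OF lin]) (simp add: prod_eq_iff)
  also have "\<dots> \<bullet> (z - z') = ip (z - z') ((w - w') - (z - z'))
      - (fst z - fst z') \<bullet> (grad h (fst w) - grad h (fst w'))"
  proof -
    have "(a, 0) \<bullet> (z - z') = (fst z - fst z') \<bullet> a" for a
      by (cases z, cases z') (simp add: inner_commute)
    then show ?thesis unfolding ip_def inner_diff_left[of "M _"] by (simp add: inner_commute)
  qed
  finally show ?thesis by simp
qed

lemma T_unique:
  assumes "z \<in> T w" "z' \<in> T w" shows "z = z'"
proof -
  have "ip (z - z') (z - z') \<le> 0" using T_firm[OF assms] by (simp add: ip_simps)
  then show ?thesis unfolding ip_eq_0 by simp
qed

text \<open>In the inclusion defining \<open>T w\<close> the second block determines \<open>y'\<close> from \<open>x'\<close>, and \<open>y'\<close> cancels from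
  the first block, which is the optimality condition of a strongly convex problem in \<open>x'\<close>.\<close>

lemma T_nonempty: "\<exists>z. z \<in> T w"
proof -
  obtain x y where w: "w = (x, y)" by (cases w)
  obtain x\<^sub>0 s\<^sub>0 where s0: "s\<^sub>0 \<in> subdifferential g x\<^sub>0"
    using zeros unfolding set_inverse_def T_map_def by fastforce
  \<comment> \<open>The smooth part of the x-subproblem: \<open>\<phi>\<close>, the proximal term of
    \<open>P\<close>, the linearisation of \<open>h\<close> at the current \<open>x\<close>, and the
    multiplier term of \<open>y\<close>.\<close>
  define \<psi> where "\<psi> z = \<phi> z + 1 / 2 * ((z - x) \<bullet> (P *v (z - x))) + (grad h x - transpose A *v y) \<bullet> z" for z
  define D\<psi> where "D\<psi> z = D\<phi> z + P *v (z - x) + (grad h x - transpose A *v y)" for z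
  have "GDERIV \<psi> z :> D\<psi> z" for z
  proof -
    have P': "((\<lambda>z. P *v (z - x)) has_derivative (\<lambda>v. P *v v)) (at z)"
      by (rule has_derivative_eq_rhs[OF bounded_linear.has_derivative[of "(*v) P"]])
        (auto intro!: derivative_eq_intros)
    have sym: "(z - x) \<bullet> (P *v v) = v \<bullet> (P *v (z - x))" for v
      using inner_symmetric_matrix[OF P, of v "z - x"] by (simp add: inner_commute)
    have d: "((\<lambda>z. z - x) has_derivative (\<lambda>v. v)) (at z)"
      by (auto intro!: derivative_eq_intros)
    have "(\<psi> has_derivative (\<lambda>v. v \<bullet> D\<phi> z + 1 / 2 * ((z - x) \<bullet> (P *v v) + v \<bullet> (P *v (z - x)))
        + (grad h x - transpose A *v y) \<bullet> v)) (at z)"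
      unfolding \<psi>_def
      by (intro has_derivative_add has_derivative_mult_right has_derivative_inner P' d
          GDERIV_\<phi>[unfolded gderiv_def] bounded_linear_imp_has_derivative bounded_linear_inner_right)
    then show ?thesis
      unfolding gderiv_def D\<psi>_def
      by (simp add: sym inner_add_right inner_commute[of "grad h x - transpose A *v y"]
          del: transpose_matrix_vector)
  qed
  moreover have "\<psi> x\<^sub>0 + D\<psi> x\<^sub>0 \<bullet> (z - x\<^sub>0) + \<mu> / 2 * (norm (z - x\<^sub>0))\<^sup>2 \<le> \<psi> z" for z
  proof -
    define u v where "u = x\<^sub>0 - x" and "v = z - x\<^sub>0"
    have zx: "z - x = u + v" unfolding u_def v_def by simp
    have "(u + v) \<bullet> (P *v (u + v)) = u \<bullet> (P *v u) + 2 * ((P *v u) \<bullet> v) + v \<bullet> (P *v v)"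
      by (simp add: matrix_vector_right_distrib inner_add_left inner_add_right
          inner_commute[of v "P *v u"] inner_symmetric_matrix[OF P, of u v])
    moreover have "\<phi> x\<^sub>0 + D\<phi> x\<^sub>0 \<bullet> v \<le> \<phi> z"
      unfolding v_def by (rule convex_on_above_gradient[OF convex_\<phi>' GDERIV_\<phi>])
    moreover have "\<mu> / 2 * (norm v)\<^sup>2 \<le> (v \<bullet> (P *v v)) / 2" using P_lower[of v] by simp
    moreover have "(grad h x - transpose A *v y) \<bullet> z
        = (grad h x - transpose A *v y) \<bullet> x\<^sub>0 + (grad h x - transpose A *v y) \<bullet> v"
      unfolding v_def by (simp add: inner_diff_right)
    ultimately show ?thesis
      unfolding \<psi>_def D\<psi>_def zx u_def[symmetric] v_def[symmetric] inner_add_left[of _ _ v]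
        distrib_left[of "1 / 2"] by (simp only: add_divide_distrib) (simp add: algebra_simps)
  qed
  ultimately obtain x' where x': "- D\<psi> x' \<in> subdifferential g x'"
    using exists_neg_gradient_subdifferential[OF g s0, of \<psi> D\<psi> "\<mu> / 2"] \<mu>_pos by auto
  \<comment> \<open>Solves the second block
    \<open>A *v (x - x') + Q *v (y - y') = A *v x' - b\<close>; the factor 2 arises because
    \<open>A *v x'\<close> occurs on both sides.\<close>
  define y' where "y' = y + matrix_inv Q *v (A *v x + b - 2 *\<^sub>R (A *v x'))"
  have "M (w - (x', y')) - (grad h x, 0)
      = (- D\<psi> x' + D\<phi> x' - transpose A *v y', A *v x' - b)"
    unfolding w y'_def M_map_def D\<psi>_def
    by (simp add: matrix_vector_right_distrib matrix_vector_mult_diff_distrib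
        matrix_vector_mult_scaleR pos_def_matrix_inv[OF Q] algebra_simps scaleR_2
        linear_neg del: transpose_matrix_vector)
  then have "(x', y') \<in> T w" unfolding T_iff A_map_iff using x' w by auto
  then show ?thesis ..
qed

lemma T_ex1: "\<exists>!z. z \<in> T w"
  using T_unique T_nonempty by blast

text \<open>At a fixed point the preconditioner term is zero, and the gradient of \<open>h\<close>
  cancels against the one subtracted in \<open>D\<phi>\<close>.\<close>

lemma T_fixed_iff: "w \<in> T w \<longleftrightarrow> w \<in> zer"
proof -
  have "w \<in> T w \<longleftrightarrow> (\<exists>s \<in> subdifferential g (fst w).
      (- grad h (fst w), 0) = (s + D\<phi> (fst w) - transpose A *v snd w, A *v fst w - b))"
    unfolding T_iff A_map_iff by (simp add: linear_0[OF lin] del: transpose_matrix_vector)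
  also have "\<dots> \<longleftrightarrow> w \<in> zer"
    unfolding set_inverse_def T_map_def D\<phi>_def
    by (cases w) (auto simp: zero_prod_def algebra_simps eq_neg_iff_add_eq_0
        simp del: transpose_matrix_vector intro!: bexI)
  finally show ?thesis .
qed

text \<open>Cocoercivity of \<open>grad h\<close> bounds the cross term from below by \<open>- L / 4\<close> times the squared
  first component of the residual difference, which the form dominates up to the factor \<open>\<mu>\<close>.\<close>

lemma relaxed_nonexpansive:
  assumes z: "z \<in> T w" and z': "z' \<in> T w'"
    and \<gamma>: "-1 < \<gamma>" "\<gamma> < 1 - L / (2 * \<mu>)"
  defines "u \<equiv> ((1 + \<gamma>) *\<^sub>R z - \<gamma> *\<^sub>R w) - ((1 + \<gamma>) *\<^sub>R z' - \<gamma> *\<^sub>R w')"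
  shows "ip u u \<le> ip (w - w') (w - w')"
proof -
  define d e r \<beta> where "d = w - w'" and "e = z - z'" and "r = d - e"
    and "\<beta> = grad h (fst w) - grad h (fst w')"
  have coco: "\<beta> \<bullet> \<beta> \<le> L * (fst d \<bullet> \<beta>)"
    using convex_lipschitz_gradient_cocoercive[OF lipschitz_h GDERIV_h convex_h, of "fst w" "fst w'"]
    unfolding \<beta>_def d_def by (simp add: power2_norm_eq_inner inner_commute)
  have cross: "- L / 4 * (norm (fst r))\<^sup>2 \<le> fst e \<bullet> \<beta>"
  proof (cases "L = 0")
    case True
    then have "\<beta> = 0" using coco by (simp add: power2_norm_eq_inner[symmetric])
    then show ?thesis using True by simp
  next
    case False
    then have L: "0 < L" using L_nonneg by simp
    \<comment> \<open>Since \<open>e = d - r\<close>, cocoercivity takes care of the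
      \<open>d\<close> part, and completing the square absorbs the \<open>r\<close> part; this is
      where \<open>L / 4\<close> comes from.\<close>
    have "0 \<le> (\<beta> - (L / 2) *\<^sub>R fst r) \<bullet> (\<beta> - (L / 2) *\<^sub>R fst r)" by simp
    also have "\<dots> = \<beta> \<bullet> \<beta> - L * (fst r \<bullet> \<beta>) + L * (L / 4 * (norm (fst r))\<^sup>2)"
      by (simp add: inner_simps inner_commute power2_norm_eq_inner)
    also have "\<dots> \<le> L * (fst d \<bullet> \<beta>) - L * (fst r \<bullet> \<beta>) + L * (L / 4 * (norm (fst r))\<^sup>2)"
      using coco by simp
    also have "\<dots> = L * (fst e \<bullet> \<beta> + L / 4 * (norm (fst r))\<^sup>2)"
      unfolding r_def by (simp add: inner_diff_left algebra_simps)
    finally show ?thesis using L by (simp add: zero_le_mult_iff)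
  qed
  have "L / 4 * (norm (fst r))\<^sup>2 \<le> L / 4 * (ip r r / \<mu>)"
    using M_lower[of r] \<mu>_pos L_nonneg unfolding ip_def by (intro mult_left_mono) (auto simp: field_simps)
  moreover have "fst e \<bullet> \<beta> \<le> ip e r"
    using T_firm[OF z z'] unfolding r_def d_def e_def \<beta>_def by simp
  moreover have "ip d r = ip e r + ip r r" unfolding r_def by (simp add: ip_simps)
  ultimately have dr: "(1 - L / (4 * \<mu>)) * ip r r \<le> ip d r"
    using cross by (simp add: algebra_simps)
  have "u = d - (1 + \<gamma>) *\<^sub>R r" unfolding u_def r_def d_def e_def by (simp add: algebra_simps)
  then have "ip u u = ip d d - (1 + \<gamma>) * (2 * ip d r - (1 + \<gamma>) * ip r r)"
    by (simp only:) (simp add: ip_simps ip_commute algebra_simps)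
  moreover have "0 \<le> 2 * ip d r - (1 + \<gamma>) * ip r r"
  proof -
    have "0 \<le> (1 - L / (2 * \<mu>) - \<gamma>) * ip r r"
      using \<gamma>(2) by (intro mult_nonneg_nonneg ip_nonneg) simp
    also have "\<dots> = 2 * ((1 - L / (4 * \<mu>)) * ip r r) - (1 + \<gamma>) * ip r r"
      using \<mu>_pos by (simp add: field_simps)
    finally show ?thesis using dr by linarith
  qed
  ultimately show ?thesis using \<gamma>(1) unfolding d_def[symmetric] by simp
qed

text \<open>The second block of the element of \<open>T_map\<close> is \<open>A *v fst z - b\<close>
  itself, so subtracting \<open>\<sigma>\<close> times its image under the transpose of
  \<open>A\<close> removes exactly the penalty gradient.\<close>

lemma residual_in_R_map:
  assumes "z \<in> T w"
  shows "E_map A \<sigma> (M (w - z) + (grad h (fst z) - grad h (fst w), 0)) \<in> R_map A b f g z"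
proof -
  obtain s where s: "s \<in> subdifferential g (fst z)"
    and eq: "M (w - z) - (grad h (fst w), 0)
      = (s + D\<phi> (fst z) - transpose A *v snd z, A *v fst z - b)"
    using assms unfolding T_iff A_map_iff by blast
  have "M (w - z) + (grad h (fst z) - grad h (fst w), 0)
      = (M (w - z) - (grad h (fst w), 0)) + (grad h (fst z), 0)" by simp
  also have "\<dots> = (s + D\<phi> (fst z) - transpose A *v snd z + grad h (fst z), A *v fst z - b)"
    unfolding eq by simp
  finally have "E_map A \<sigma> (M (w - z) + (grad h (fst z) - grad h (fst w), 0))
      = (grad f (fst z) + s - transpose A *v snd z, A *v fst z - b)"
    by (simp add: E_map_def D\<phi>_def algebra_simps del: transpose_matrix_vector)
  then show ?thesis using s unfolding R_map_def by (cases z) auto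
qed

lemma bounded_linear_E_map: "bounded_linear (E_map A \<sigma>)"
  unfolding linear_conv_bounded_linear[symmetric]
  by (rule linearI) (auto simp: E_map_def matrix_vector_right_distrib matrix_vector_mult_scaleR
      algebra_simps simp del: transpose_matrix_vector)

lemma r_KKT_le:
  assumes "z \<in> T w"
  shows "r_KKT A b f g z
    \<le> ereal (onorm (E_map A \<sigma>) * ((sqrt (onorm M) + L / sqrt \<mu>) * norm_wrt M (w - z)))"
proof -
  let ?v = "M (w - z) + (grad h (fst z) - grad h (fst w), 0)"
  have "r_KKT A b f g z \<le> ereal (norm (E_map A \<sigma> ?v))"
    unfolding r_KKT_def using INF_lower[OF residual_in_R_map[OF assms], of "\<lambda>u. ereal (dist 0 u)"] by simp
  also have "norm (E_map A \<sigma> ?v) \<le> onorm (E_map A \<sigma>) * norm ?v"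
    by (rule onorm[OF bounded_linear_E_map])
  also have "\<dots> \<le> onorm (E_map A \<sigma>) * ((sqrt (onorm M) + L / sqrt \<mu>) * norm_wrt M (w - z))"
  proof (rule mult_left_mono[OF _ onorm_pos_le[OF bounded_linear_E_map]])
    have "norm (grad h (fst z) - grad h (fst w)) \<le> L * norm (fst (w - z))"
      using lipschitz_onD[OF lipschitz_h, of "fst z" "fst w"] by (simp add: dist_norm norm_minus_commute)
    also have "\<dots> \<le> L * (norm_wrt M (w - z) / sqrt \<mu>)"
      by (intro mult_left_mono norm_fst_le_norm_wrt L_nonneg)
    finally have "norm (grad h (fst z) - grad h (fst w), 0 :: real^'m) \<le> L * (norm_wrt M (w - z) / sqrt \<mu>)"
      by (simp add: norm_Pair)
    then show "norm ?v \<le> (sqrt (onorm M) + L / sqrt \<mu>) * norm_wrt M (w - z)"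
      using norm_wrt_bound[of "w - z"] by (intro norm_triangle_le) (simp add: algebra_simps)
  qed
  finally show ?thesis by simp
qed

text \<open>The second block forces feasibility, and there the penalty gradient vanishes.\<close>

lemma zer_eq_R_zeros: "zer = set_inverse (R_map A b f g) 0"
proof (rule set_eqI)
  fix w :: "(real^'n) \<times> (real^'m)"
  obtain x y where w: "w = (x, y)" by (cases w)
  have "w \<in> zer \<longleftrightarrow> (\<exists>s \<in> subdifferential g x. s + grad f x - transpose A *v y
      + \<sigma> *\<^sub>R (transpose A *v (A *v x - b)) = 0 \<and> A *v x - b = 0)"
    unfolding set_inverse_def T_map_def w zero_prod_def by (auto simp del: transpose_matrix_vector)
  also have "\<dots> \<longleftrightarrow> (\<exists>s \<in> subdifferential g x. grad f x + s - transpose A *v y = 0 \<and> A *v x - b = 0)"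
    by (intro bex_cong refl) (auto simp: add.commute simp del: transpose_matrix_vector)
  also have "\<dots> \<longleftrightarrow> w \<in> set_inverse (R_map A b f g) 0"
    unfolding set_inverse_def R_map_def w zero_prod_def by (auto simp del: transpose_matrix_vector)
  finally show "w \<in> zer \<longleftrightarrow> w \<in> set_inverse (R_map A b f g) 0" .
qed

text \<open>The vector \<open>fst u + transpose A *v y\<close> is the sum of \<open>grad f x\<close>
  and a subgradient of \<open>g\<close>, hence a subgradient of the objective at
  \<open>x\<close>.\<close>

lemma Phi_below:
  assumes u: "u \<in> R_map A b f g (x, y)"
  obtains c where "g x = ereal c"
    "\<And>z t. g z = ereal t \<Longrightarrow> f x + c + (fst u + transpose A *v y) \<bullet> (z - x) \<le> f z + t"
    "snd u = A *v x - b"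
proof -
  obtain s where s: "s \<in> subdifferential g x"
    and u: "u = (grad f x + s - transpose A *v y, A *v x - b)"
    using u unfolding R_map_def by auto
  obtain c where c: "g x = ereal c" using subdifferential_finite[OF g s] .
  have "f x + c + (fst u + transpose A *v y) \<bullet> (z - x) \<le> f z + t" if t: "g z = ereal t" for z t
  proof -
    have "g x + ereal (s \<bullet> (z - x)) \<le> g z" using s unfolding subdifferential_def by blast
    then have "c + s \<bullet> (z - x) \<le> t" by (simp add: c t)
    moreover have "f x + grad f x \<bullet> (z - x) \<le> f z"
      by (rule convex_on_above_gradient[OF convex_f GDERIV_f])
    moreover have "fst u + transpose A *v y = grad f x + s" unfolding u by simp
    ultimately show ?thesis by (simp add: inner_add_left)
  qed
  with c u that show ?thesis by simp
qed

text \<open>Feasibility of \<open>x'\<close> turns each multiplier term into an inner product with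
  \<open>snd u\<close>, so it is of the size of the residual. The upper bound contributes
  \<open>norm (x - x')\<close> and \<open>norm y\<close>, the lower one \<open>norm y'\<close>: the
  three parts of the constant.\<close>

lemma Phi_gap_le:
  assumes u: "u \<in> R_map A b f g (x, y)" and p: "(x', y') \<in> zer"
  shows "\<bar>Phi f g x - Phi f g x'\<bar> \<le> ereal ((norm (x - x') + norm y + norm y') * norm u)"
proof -
  have "0 \<in> R_map A b f g (x', y')" using p unfolding zer_eq_R_zeros by (simp add: set_inverse_def)
  then obtain c' where c': "g x' = ereal c'"
    "\<And>z t. g z = ereal t \<Longrightarrow> f x' + c' + (transpose A *v y') \<bullet> (z - x') \<le> f z + t"
    "A *v x' = b"
    by (rule Phi_below) (auto simp del: transpose_matrix_vector)
  obtain c where c: "g x = ereal c"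
    "\<And>z t. g z = ereal t \<Longrightarrow> f x + c + (fst u + transpose A *v y) \<bullet> (z - x) \<le> f z + t"
    "snd u = A *v x - b"
    using Phi_below[OF u] by blast
  have v: "A *v (x - x') = snd u" unfolding c(3) by (simp add: matrix_vector_mult_diff_distrib c'(3))
  have tr: "(transpose A *v q) \<bullet> (x - x') = q \<bullet> snd u" for q
    using inner_matrix_vector[of "x - x'" A q] unfolding v by (simp add: inner_commute)
  have n: "norm (fst u) \<le> norm u" "norm (snd u) \<le> norm u" 
    using norm_fst_le[of "fst u" "snd u"] norm_snd_le[of "snd u" "fst u"] by simp_all
  have "f x + c - (f x' + c') \<le> (fst u + transpose A *v y) \<bullet> (x - x')"
    using c(2)[OF c'(1)] by (simp add: inner_diff_right)
  also have "\<dots> = fst u \<bullet> (x - x') + y \<bullet> snd u" by (simp only: inner_add_left tr)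
  also have "\<dots> \<le> norm (fst u) * norm (x - x') + norm y * norm (snd u)"
    by (intro add_mono norm_cauchy_schwarz)
  also have "\<dots> \<le> norm u * norm (x - x') + norm y * norm u"
    using n by (intro add_mono mult_right_mono mult_left_mono) auto
  finally have up: "f x + c - (f x' + c') \<le> norm u * norm (x - x') + norm y * norm u" .
  have "f x' + c' - (f x + c) \<le> - (y' \<bullet> snd u)"
    using c'(2)[OF c(1)] unfolding tr by simp
  also have "\<dots> \<le> norm y' * norm (snd u)"
    using Cauchy_Schwarz_ineq2[of y' "snd u"] by simp
  also have "\<dots> \<le> norm y' * norm u" using n by (intro mult_left_mono) auto
  finally have lo: "f x' + c' - (f x + c) \<le> norm y' * norm u" .
  have "0 \<le> norm u * norm (x - x')" "0 \<le> norm y * norm u" "0 \<le> norm y' * norm u" by simp_all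
  moreover have "(norm (x - x') + norm y + norm y') * norm u
      = norm u * norm (x - x') + norm y * norm u + norm y' * norm u"
    by (simp add: algebra_simps)
  ultimately have "\<bar>f x + c - (f x' + c')\<bar> \<le> (norm (x - x') + norm y + norm y') * norm u"
    using up lo by linarith
  then show ?thesis by (simp add: Phi_def c(1) c'(1))
qed

end

theorem theorem3:
  fixes A :: "real^'n^'m" and b :: "real^'m" and \<sigma> :: real
    and P :: "real^'n^'n" and Q :: "real^'m^'m"
    and f h :: "real^'n \<Rightarrow> real" and g :: "real^'n \<Rightarrow> ereal"
    and L\<^sub>h \<mu>\<^sub>x \<gamma> :: real
    and w0 :: "(real^'n) \<times> (real^'m)"
    and w what wbar :: "nat \<Rightarrow> (real^'n) \<times> (real^'m)"
  assumes "\<sigma> \<ge> 0"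
    and "convex_on UNIV f" and "cont_differentiable f"
    and "\<exists>L. L-lipschitz_on UNIV (grad f)"
    and "proper_closed_convex g"
    and "\<exists>x. A *v x = b"
    and "\<exists>x. is_arg_min (Phi f g) (\<lambda>x. A *v x = b) x"
    and "transpose P = P" and "transpose Q = Q"
    and "convex_on UNIV h" and "cont_differentiable h"
    and "L\<^sub>h-lipschitz_on UNIV (grad h)"
    and "convex_on UNIV (\<lambda>x. f x - h x + \<sigma> / 2 * (norm (A *v x - b))\<^sup>2)"
    and "pos_def Q"
    and "pos_def (P - transpose A ** matrix_inv Q ** A)"
    and "\<mu>\<^sub>x = lambda_min (P - transpose A ** matrix_inv Q ** A)"
    and "\<mu>\<^sub>x > L\<^sub>h / 2"
    and "set_inverse (T_map A b \<sigma> f g) 0 \<noteq> {}"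
    and "\<gamma> \<in> {-1 <..< 1 - L\<^sub>h / (2 * \<mu>\<^sub>x)}"
    and "w 0 = w0"
    and "\<And>k. what k \<in> T_lin P Q A b \<sigma> f g h (w k)"
    and "\<And>k. wbar k = (1 + \<gamma>) *\<^sub>R what k - \<gamma> *\<^sub>R w k"
    and "\<And>k. w (Suc k) = (1 / (real k + 2)) *\<^sub>R w0 + ((real k + 1) / (real k + 2)) *\<^sub>R wbar k"
  shows "(\<forall>z. z \<noteq> 0 \<longrightarrow> 0 < z \<bullet> M_map P Q A z) \<and>
    (\<forall>z. \<exists>!v. v \<in> T_lin P Q A b \<sigma> f g h z) \<and>
    (\<exists>xstar ystar.
      w \<longlonglongrightarrow> (xstar, ystar) \<and> wbar \<longlonglongrightarrow> (xstar, ystar) \<and> what \<longlonglongrightarrow> (xstar, ystar) \<and>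
      (xstar, ystar) \<in> set_inverse (T_map A b \<sigma> f g) 0 \<and>
      set_inverse (T_map A b \<sigma> f g) 0 = set_inverse (R_map A b f g) 0 \<and>
      (\<forall>k. r_KKT A b f g (what k) \<le>
         ereal (2 * onorm (E_map A \<sigma>) / ((1 + \<gamma>) * (real k + 1))
           * (sqrt (onorm (M_map P Q A)) + L\<^sub>h / sqrt \<mu>\<^sub>x)
           * dist_wrt (M_map P Q A) w0 (set_inverse (T_map A b \<sigma> f g) 0))) \<and>
      (\<lambda>k. real_of_ereal (r_KKT A b f g (what k))) \<in> O(\<lambda>k. 1 / real k) \<and>
      (let C = (SUP k. ereal (norm (fst (what k) - xstar) + norm (snd (what k)))) + ereal (norm ystar)
       in C < \<infinity> \<and>
          (\<forall>k. \<bar>Phi f g (fst (what k)) - Phi f g xstar\<bar> \<le> C * r_KKT A b f g (what k))) \<and>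
      (\<lambda>k. real_of_ereal \<bar>Phi f g (fst (what k)) - Phi f g xstar\<bar>) \<in> O(\<lambda>k. 1 / real k))"
proof -
  interpret linearized_proximal A P Q \<mu>\<^sub>x b \<sigma> f h g L\<^sub>h
    by unfold_locales (use assms in simp_all)
  note what = assms(21) and wbar = assms(22) and w0 = assms(20)
  have \<gamma>: "-1 < \<gamma>" "\<gamma> < 1 - L\<^sub>h / (2 * \<mu>\<^sub>x)" using assms(19) by auto
  define F where "F z = (1 + \<gamma>) *\<^sub>R (THE v. v \<in> T z) - \<gamma> *\<^sub>R z" for z
  have The: "(THE v. v \<in> T z) \<in> T z" for z by (rule theI'[OF T_ex1])
  have F_eq: "F z = (1 + \<gamma>) *\<^sub>R v - \<gamma> *\<^sub>R z" if "v \<in> T z" for v z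
    unfolding F_def using T_unique[OF The that] by simp
  have Fw: "F (w k) = wbar k" for k unfolding wbar by (rule F_eq[OF what])
  interpret halpern "M_map P Q A" F w
  proof (unfold_locales, unfold Fw w0)
    show "ip (F x - F y) (F x - F y) \<le> ip (x - y) (x - y)" for x y
      unfolding F_def by (rule relaxed_nonexpansive[OF The The \<gamma>])
  qed (rule assms(23))
  have fixed: "F z = z \<longleftrightarrow> z \<in> zer" for z
  proof -
    obtain v where v: "v \<in> T z" using T_nonempty by blast
    have "F z - z = (1 + \<gamma>) *\<^sub>R (v - z)" unfolding F_eq[OF v] by (simp add: algebra_simps)
    then have "F z = z \<longleftrightarrow> v = z" using \<gamma>(1) by (metis add.inverse_inverse add_eq_0_iff eq_iff_diff_eq_0 less_irrefl scaleR_eq_0_iff)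
    then show ?thesis using v T_unique T_fixed_iff by metis
  qed
  obtain q where "F q = q" using zeros fixed by blast
  then obtain p where p: "F p = p" "w \<longlonglongrightarrow> p" by (rule convergence)
  obtain xs ys where ps: "p = (xs, ys)" by (cases p)
  have p_zer: "(xs, ys) \<in> zer" using p(1) fixed ps by simp
  have wbar_lim: "wbar \<longlonglongrightarrow> p"
    using tendsto_diff[OF p(2) residual_tendsto_0[OF p(1)]] unfolding Fw by simp
  have res: "w k - what k = (1 / (1 + \<gamma>)) *\<^sub>R (w k - F (w k))" for k
  proof -
    have "w k - F (w k) = (1 + \<gamma>) *\<^sub>R (w k - what k)" unfolding Fw wbar by (simp add: algebra_simps)
    then show ?thesis using \<gamma>(1) by simp
  qed
  have "(\<lambda>k. w k - (1 / (1 + \<gamma>)) *\<^sub>R (w k - F (w k))) \<longlonglongrightarrow> p - (1 / (1 + \<gamma>)) *\<^sub>R 0"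
    by (intro tendsto_intros p(2) residual_tendsto_0[OF p(1)])
  then have what_lim: "what \<longlonglongrightarrow> p" unfolding res[symmetric] by simp

  \<comment> \<open>The rate of the KKT residual\<close>
  let ?d = "dist_wrt M w0 zer"
  define K where "K = 2 * onorm (E_map A \<sigma>) / (1 + \<gamma>) * (sqrt (onorm M) + L\<^sub>h / sqrt \<mu>\<^sub>x) * ?d"
  have rate: "r_KKT A b f g (what k) \<le> ereal (2 * onorm (E_map A \<sigma>) / ((1 + \<gamma>) * (real k + 1))
      * (sqrt (onorm M) + L\<^sub>h / sqrt \<mu>\<^sub>x) * ?d)" for k
  proof -
    \<comment> \<open>The rate holds for every zero; solved for the distance, it passes to the
      infimum without a nearest zero.\<close>
    have "(real k + 1) / 2 * norm_wrt M (w k - F (w k)) \<le> ?d"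
      unfolding dist_wrt_def
    proof (rule cINF_greatest[OF zeros])
      fix z assume "z \<in> zer"
      then have "norm_wrt M (w k - F (w k)) \<le> 2 / (real k + 1) * norm_wrt M (w0 - z)"
        using residual_rate[of z k] fixed w0 by simp
      then show "(real k + 1) / 2 * norm_wrt M (w k - F (w k)) \<le> norm_wrt M (w0 - z)"
        by (simp add: field_simps)
    qed
    then have "norm_wrt M (w k - F (w k)) / (1 + \<gamma>) \<le> 2 * ?d / (real k + 1) / (1 + \<gamma>)"
      using \<gamma>(1) by (intro divide_right_mono) (auto simp: field_simps)
    moreover have "norm_wrt M (w k - what k) = norm_wrt M (w k - F (w k)) / (1 + \<gamma>)"
      unfolding res using \<gamma>(1) by (simp add: norm_wrt_scaleR)
    ultimately have "norm_wrt M (w k - what k) \<le> 2 / ((1 + \<gamma>) * (real k + 1)) * ?d"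
      by (simp add: mult.commute)
    then have "onorm (E_map A \<sigma>) * ((sqrt (onorm M) + L\<^sub>h / sqrt \<mu>\<^sub>x) * norm_wrt M (w k - what k))
        \<le> onorm (E_map A \<sigma>) * ((sqrt (onorm M) + L\<^sub>h / sqrt \<mu>\<^sub>x) * (2 / ((1 + \<gamma>) * (real k + 1)) * ?d))"
      using L_nonneg \<mu>_pos onorm_pos_le[OF bounded_linear_M] onorm_pos_le[OF bounded_linear_E_map]
      by (intro mult_left_mono) auto
    then show ?thesis
      by (intro order_trans[OF r_KKT_le[OF what[of k]]]) (simp add: mult_ac)
  qed
  have "\<exists>r. r_KKT A b f g (what k) = ereal r \<and> 0 \<le> r" for k
  proof -
    have "0 \<le> r_KKT A b f g (what k)" unfolding r_KKT_def by (rule INF_greatest) simp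
    then show ?thesis using rate[of k] by (cases "r_KKT A b f g (what k)") auto
  qed
  then obtain r where r: "\<And>k. r_KKT A b f g (what k) = ereal (r k)" "\<And>k. 0 \<le> r k" by metis
  have r_le: "r k \<le> K / (real k + 1)" for k
    using rate[of k] unfolding r K_def by (simp add: mult_ac)
  have bigo: "s \<in> O(\<lambda>k. 1 / real k)" if s: "\<And>k. \<bar>s k\<bar> \<le> c * r k" "0 \<le> c" for s :: "nat \<Rightarrow> real" and c
  proof (rule bigoI)
    show "\<forall>\<^sub>F k in sequentially. norm (s k) \<le> c * K * norm (1 / real k)"
      \<comment> \<open>At \<open>k = 0\<close> the comparison function \<open>1 / real k\<close> is
        0 by convention.\<close>
      using eventually_gt_at_top[of 0]
    proof eventually_elim
      case (elim k)
      have "0 \<le> K" using r(2)[of 0] r_le[of 0] by simp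
      then have "r k \<le> K / real k"
        using elim by (intro order_trans[OF r_le] divide_left_mono) auto
      then have "c * r k \<le> c * (K / real k)" using s(2) by (rule mult_left_mono)
      then show ?case using s(1)[of k] by simp
    qed
  qed

  \<comment> \<open>The objective gap\<close>
  let ?t = "\<lambda>k. norm (fst (what k) - xs) + norm (snd (what k))"
  \<comment> \<open>Convergence of \<open>what\<close> supplies the real bound that makes the
    extended-real supremum finite.\<close>
  have "convergent ?t"
    unfolding convergent_def by (intro exI) (rule tendsto_intros what_lim)+
  then have "Bseq ?t" by (rule convergent_imp_Bseq)
  then obtain B where "\<forall>k. norm (?t k) \<le> B" by (rule BseqE)
  then have B: "?t k \<le> B" for k by (auto simp: abs_le_iff)
  define C where "C = (SUP k. ereal (?t k)) + ereal (norm ys)"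
  have "(SUP k. ereal (?t k)) \<le> ereal B"
    by (rule SUP_least) (simp add: B)
  moreover have t_le: "ereal (?t k) \<le> (SUP k. ereal (?t k))" for k by (rule SUP_upper) simp
  ultimately obtain s where s: "(SUP k. ereal (?t k)) = ereal s"
    using t_le[of 0] by (cases "SUP k. ereal (?t k)") auto
  define c where "c = s + norm ys"
  have C: "C = ereal c" unfolding C_def s c_def by simp
  have tc: "?t k + norm ys \<le> c" for k using t_le[of k] unfolding s c_def by simp
  have c_nonneg: "0 \<le> c" using tc[of 0] by (smt (verit) norm_ge_zero)
  have gap: "\<bar>Phi f g (fst (what k)) - Phi f g xs\<bar> \<le> ereal (c * r k)" for k
  proof -
    let ?D = "\<bar>Phi f g (fst (what k)) - Phi f g xs\<bar>"
    have le: "?D \<le> ereal (c * norm u)" if "u \<in> R_map A b f g (what k)" for u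
    proof -
      have "?D \<le> ereal ((?t k + norm ys) * norm u)"
        using Phi_gap_le[of u "fst (what k)" "snd (what k)", OF _ p_zer] that by simp
      also have "\<dots> \<le> ereal (c * norm u)" using tc[of k] by (simp add: mult_right_mono)
      finally show ?thesis .
    qed
    obtain u where u: "u \<in> R_map A b f g (what k)" using residual_in_R_map[OF what] by blast
    obtain D where D: "?D = ereal D" using le[OF u] by (cases ?D) auto
    \<comment> \<open>The bound holds for every element of \<open>R_map\<close> and reaches the
      infimum after division by \<open>c\<close>, so \<open>c = 0\<close> is treated apart.\<close>
    show ?thesis
    proof (cases "c = 0")
      case True then show ?thesis using le[OF u] by simp
    next
      case False
      then have c: "0 < c" using c_nonneg by simp
      have "ereal (D / c) \<le> r_KKT A b f g (what k)"
        unfolding r_KKT_def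
        by (rule INF_greatest) (use le c in \<open>auto simp: D field_simps\<close>)
      then show ?thesis using c unfolding r D by (simp add: field_simps)
    qed
  qed
  have gap_bigo: "(\<lambda>k. real_of_ereal \<bar>Phi f g (fst (what k)) - Phi f g xs\<bar>) \<in> O(\<lambda>k. 1 / real k)"
  proof (rule bigo[OF _ c_nonneg])
    fix k show "\<bar>real_of_ereal \<bar>Phi f g (fst (what k)) - Phi f g xs\<bar>\<bar> \<le> c * r k"
      using gap[of k] by (cases "Phi f g (fst (what k)) - Phi f g xs") auto
  qed
  have r_bigo: "(\<lambda>k. real_of_ereal (r_KKT A b f g (what k))) \<in> O(\<lambda>k. 1 / real k)"
    unfolding r by (rule bigo[of _ 1]) (use r(2) in auto)
  show ?thesis
  proof (intro conjI exI[of _ xs] exI[of _ ys])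
    show "\<forall>z. z \<noteq> 0 \<longrightarrow> 0 < z \<bullet> M_map P Q A z" using pos by blast
    show "\<forall>z. \<exists>!v. v \<in> T_lin P Q A b \<sigma> f g h z" using T_ex1 by blast
    show "let C = (SUP k. ereal (?t k)) + ereal (norm ys)
       in C < \<infinity> \<and> (\<forall>k. \<bar>Phi f g (fst (what k)) - Phi f g xs\<bar> \<le> C * r_KKT A b f g (what k))"
      using gap unfolding Let_def C_def[symmetric] C r by simp
  qed (use p(2) wbar_lim what_lim p_zer zer_eq_R_zeros rate r_bigo gap_bigo ps in auto)
qed

end
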